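(* For the weight function $w_{\frac12,\frac12}$ on $\triangle^*$, the cubature rule $$c_{\frac12,\frac12}\iint_{\triangle^*}f(x,y)\,w_{\frac12,\frac12}(x,y)\,dx\,dy=\frac{12}{(n+5)^2}\sum_{\mathbf j\in\Upsilon^\circ_{n+5}}\left|\mathsf{SS}_{2,1,-3}\!\left(\tfrac{\mathbf j}{n+5}\right)\right|^2f\!\left(x\!\left(\tfrac{\mathbf j}{n+5}\right),y\!\left(\tfrac{\mathbf j}{n+5}\right)\right)$$ is exact for all polynomials $f\in\Pi^*_{2n-1}$.
   Context: Here $n$ is a positive integer. Let $\triangle=\{\mathbf t=(t_1,t_2,t_3)\in\mathbb R^3:t_1+t_2+t_3=0,\ 0\le t_2\le t_1\le-t_3\le1\}$. Define $x(\mathbf t)=\frac13\left(\cos\frac{2\pi(t_1-t_2)}3+\cos\frac{2\pi(2t_1+t_2)}3+\cos\frac{2\pi(t_1+2t_2)}3\right)$, $y(\mathbf t)=\frac13\left(\cos2\pi t_1+\cos2\pi t_2+\cos2\pi(t_1+t_2)\right)$, and let $\triangle^*\subset\mathbb R^2$ be the image of $\triangle$ under $\mathbf t\mapsto(x(\mathbf t),y(\mathbf t))$. The weight is $w_{\alpha,\beta}(x,y)=\frac{(4\pi^2)^{\alpha+\beta}}{3^{2\alpha+\beta}}(1+2y-3x^2)^\alpha(24x^3-y^2-12xy-6x-4y-1)^\beta$ (both factors are nonnegative on $\triangle^*$), and $c_{\alpha,\beta}=1/\int_{\triangle^*}w_{\alpha,\beta}(x,y)\,dx\,dy$ is the normalization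 constant. $\Upsilon_m^\circ=\{\mathbf j=(j_1,j_2,j_3)\in\mathbb Z^3:j_1+j_2+j_3=0,\ j_1\equiv j_2\equiv j_3\ (\mathrm{mod}\ 3),\ 0<j_2<j_1<-j_3<m\}$. For $\mathbf k\in\mathbb Z^3$ with $k_1+k_2+k_3=0$, $\mathsf{SS}_{\mathbf k}(\mathbf t)=\frac13\left[\sin\frac{\pi(k_1-k_3)(t_1-t_3)}3\sin\pi k_2t_2+\sin\frac{\pi(k_1-k_3)(t_2-t_1)}3\sin\pi k_2t_3+\sin\frac{\pi(k_1-k_3)(t_3-t_2)}3\sin\pi k_2t_1\right]$. $\Pi_m^*=\mathrm{span}\{x^{k_1}y^{k_2}:k_1,k_2\ge0,\ 2k_1+3k_2\le m\}$.
   Formalization: The constant 12/(n+5)^2 is replaced by 144/(n+5)^2; as printed the rule fails for n=1, f=1, where the left side is 1 and the right side is 1/12. *)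

theory Defs
  imports "HOL-Analysis.Analysis" "HOL-Library.Function_Algebras"
    "HOL-Number_Theory.Cong"
begin

text \<open>The triangle, in homogeneous coordinates \<open>t\<^sub>1 + t\<^sub>2 + t\<^sub>3 = 0\<close>, and its image in the plane.\<close>

definition tri :: "(real \<times> real \<times> real) set" where
  "tri = {(t1, t2, t3). t1 + t2 + t3 = 0 \<and> 0 \<le> t2 \<and> t2 \<le> t1 \<and> t1 \<le> - t3 \<and> - t3 \<le> 1}"

definition x_coord :: "real \<times> real \<times> real \<Rightarrow> real" where
  "x_coord = (\<lambda>(t1, t2, t3).
     (1/3) * (cos (2 * pi * (t1 - t2) / 3) + cos (2 * pi * (2 * t1 + t2) / 3)
              + cos (2 * pi * (t1 + 2 * t2) / 3)))"

definition y_coord :: "real \<times> real \<times> real \<Rightarrow> real" where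
  "y_coord = (\<lambda>(t1, t2, t3).
     (1/3) * (cos (2 * pi * t1) + cos (2 * pi * t2) + cos (2 * pi * (t1 + t2))))"

definition tri_star :: "(real \<times> real) set" where
  "tri_star = (\<lambda>t. (x_coord t, y_coord t)) ` tri"

text \<open>Only the values on \<^const>\<open>tri_star\<close> matter; there both bases are nonnegative.\<close>

definition weight :: "real \<Rightarrow> real \<Rightarrow> real \<times> real \<Rightarrow> real" where
  "weight \<alpha> \<beta> = (\<lambda>(x, y).
     (4 * pi^2) powr (\<alpha> + \<beta>) / 3 powr (2 * \<alpha> + \<beta>)
     * (1 + 2 * y - 3 * x^2) powr \<alpha>
     * (24 * x^3 - y^2 - 12 * x * y - 6 * x - 4 * y - 1) powr \<beta>)"

definition weight_const :: "real \<Rightarrow> real \<Rightarrow> real" where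
  "weight_const \<alpha> \<beta> = 1 / (LINT p:tri_star|lborel. weight \<alpha> \<beta> p)"

definition Upsilon_int :: "int \<Rightarrow> (int \<times> int \<times> int) set" where
  "Upsilon_int m = {(j1, j2, j3). j1 + j2 + j3 = 0 \<and> [j1 = j2] (mod 3) \<and> [j2 = j3] (mod 3)
     \<and> 0 < j2 \<and> j2 < j1 \<and> j1 < - j3 \<and> - j3 < m}"

definition node :: "int \<Rightarrow> int \<times> int \<times> int \<Rightarrow> real \<times> real \<times> real" where
  "node m = (\<lambda>(j1, j2, j3).
     (real_of_int j1 / real_of_int m, real_of_int j2 / real_of_int m, real_of_int j3 / real_of_int m))"

text \<open>
  The indices of interest satisfy \<open>k\<^sub>1 + k\<^sub>2 + k\<^sub>3 = 0\<close>.
  With the factor \<open>1/3\<close>, the mean of \<open>\<bar>SS (2, 1, -3) t\<bar>\<^sup>2\<close> over the triangle is \<open>1/12\<close>, not \<open>1\<close>.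
  A cubature rule for the normalized weight that is written with these squares therefore carries
  the constant \<open>12 * 12 / m\<^sup>2 = 144 / m\<^sup>2\<close> (the literature also prints \<open>12 / m\<^sup>2\<close>, which is not exact even
  for constant functions).
\<close>

definition SS :: "int \<times> int \<times> int \<Rightarrow> real \<times> real \<times> real \<Rightarrow> real" where
  "SS = (\<lambda>(k1, k2, k3) (t1, t2, t3).
     (1/3) * (sin (pi * of_int (k1 - k3) * (t1 - t3) / 3) * sin (pi * of_int k2 * t2)
            + sin (pi * of_int (k1 - k3) * (t2 - t1) / 3) * sin (pi * of_int k2 * t3)
            + sin (pi * of_int (k1 - k3) * (t3 - t2) / 3) * sin (pi * of_int k2 * t1)))"

text \<open>
  Polynomial functions with \<open>x\<close> of weight \<open>2\<close> and \<open>y\<close> of weight \<open>3\<close>; the type of coefficients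
  is left open so as to cover both real and complex ones.
\<close>

definition Pi_star :: "nat \<Rightarrow> (real \<times> real \<Rightarrow> 'a::real_normed_field) set" where
  "Pi_star m = module.span (\<lambda>c f p. c * f p)
     {(\<lambda>(x, y). of_real (x ^ k1 * y ^ k2)) | k1 k2. 2 * k1 + 3 * k2 \<le> m}"

end

theory Submission
  imports Defs
begin

text \<open>
  In the coordinates \<open>s = (t\<^sub>1 - t\<^sub>2) / 3\<close>, \<open>t = (t\<^sub>1 + 2 t\<^sub>2) / 3\<close> the nodes become integral points divided by
  \<open>M = n + 5\<close>, and \<open>z = e\<^sup>2\<^sup>\<pi>\<^sup>i\<^sup>s + e\<^sup>2\<^sup>\<pi>\<^sup>i\<^sup>t + e\<^sup>-\<^sup>2\<^sup>\<pi>\<^sup>i\<^sup>(\<^sup>s\<^sup>+\<^sup>t\<^sup>)\<close> satisfies \<open>x = Re z / 3\<close> and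
  \<open>y = (\<bar>z\<bar>\<^sup>2 - 3) / 6\<close>. The two factors of the weight are squares, of \<open>Im z\<close> and of the Jacobian of
  \<open>(s, t) \<mapsto> z\<close> up to constants, and \<open>SS\<close> is a multiple of their product. Hence the weighted integral of \<open>f\<close> is a multiple of
  the integral over a triangle of \<open>F = SS\<^sup>2 f\<close>, which is a trigonometric polynomial of degree less than \<open>2 M\<close>,
  invariant under the affine Weyl group of type \<open>G\<^sub>2\<close> and zero on the walls.

  The sum of such an \<open>F\<close> over the grid of all points with denominator \<open>M\<close> modulo \<open>1\<close> is \<open>M\<^sup>2\<close> times its constant
  coefficient, and it is \<open>12\<close> times the sum over the interior nodes of the triangle. So the Riemann sums of \<open>F\<close>
  over the triangle do not depend on \<open>M\<close> as soon as \<open>M\<close> is large enough, and they are equal to their limit, the integral.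
\<close>

section \<open>Trigonometric polynomials on the hexagonal torus\<close>


definition expo :: "int \<Rightarrow> int \<Rightarrow> real \<times> real \<Rightarrow> complex" where
  "expo k l s = cis (2 * pi * (of_int k * fst s + of_int l * snd s))"

text \<open>
  The degree is the hexagonal norm of the frequency, for which the frequencies of \<open>x\<close> have norm \<open>2\<close>,
  those of \<open>y\<close> have norm \<open>3\<close>, and the nonzero multiples of \<open>M\<close> have norm at least \<open>2 M\<close>.
\<close>

inductive trig_poly :: "nat \<Rightarrow> (real \<times> real \<Rightarrow> complex) \<Rightarrow> bool" for N where
  expo: "\<lbrakk>\<bar>2 * k - l\<bar> \<le> int N; \<bar>2 * l - k\<bar> \<le> int N; \<bar>k + l\<bar> \<le> int N\<rbrakk> \<Longrightarrow> trig_poly N (expo k l)"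
| add: "\<lbrakk>trig_poly N F; trig_poly N G\<rbrakk> \<Longrightarrow> trig_poly N (\<lambda>s. F s + G s)"
| scale: "trig_poly N F \<Longrightarrow> trig_poly N (\<lambda>s. c * F s)"

lemma trig_poly_mono: "trig_poly N F \<Longrightarrow> N \<le> M \<Longrightarrow> trig_poly M F"
  by (induction rule: trig_poly.induct) (auto intro: trig_poly.intros)

lemma expo_mult: "expo k l s * expo k' l' s = expo (k + k') (l + l') s"
  by (simp add: expo_def cis_mult algebra_simps)

lemma trig_poly_const: "trig_poly N (\<lambda>s. c)"
  using trig_poly.scale[OF trig_poly.expo[of 0 0 N], of c] by (simp add: expo_def)

text \<open>The three linear forms that bound the degree are additive in the frequency, so degrees
  add when exponentials are multiplied; bilinearity does the rest.\<close>

lemma trig_poly_mult: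
  assumes "trig_poly N F" "trig_poly M G"
  shows "trig_poly (N + M) (\<lambda>s. F s * G s)"
  using assms(1)
proof (induction rule: trig_poly.induct)
  case (expo k l)
  show ?case
    using assms(2)
  proof (induction rule: trig_poly.induct)
    case (expo k' l')
    have "(\<lambda>s. expo k l s * expo k' l' s) = expo (k + k') (l + l')"
      by (rule ext) (rule expo_mult)
    moreover have "trig_poly (N + M) (expo (k + k') (l + l'))"
      using expo \<open>\<bar>2 * k - l\<bar> \<le> int N\<close> \<open>\<bar>2 * l - k\<bar> \<le> int N\<close> \<open>\<bar>k + l\<bar> \<le> int N\<close>
      by (intro trig_poly.expo) auto
    ultimately show ?case by simp
  next
    case (add F G)
    then show ?case using trig_poly.add by (simp add: distrib_left)
  next
    case (scale F c)
    then show ?case using trig_poly.scale[of "N + M" _ c] by (simp add: mult.left_commute)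
  qed
next
  case (add F G)
  then show ?case using trig_poly.add by (simp add: distrib_right)
next
  case (scale F c)
  then show ?case using trig_poly.scale[of "N + M" _ c] by (simp add: mult.assoc)
qed

lemma trig_poly_power:
  assumes "trig_poly N F"
  shows "trig_poly (k * N) (\<lambda>s. F s ^ k)"
proof (induction k)
  case 0
  show ?case using trig_poly_const[of 0 1] by simp
next
  case (Suc k)
  show ?case using trig_poly_mult[OF assms Suc] by simp
qed

text \<open>A geometric sum whose ratio is an \<open>M\<close>-th root of unity, and that ratio is 1
  exactly when \<open>M\<close> divides \<open>k\<close>.\<close>

lemma sum_roots_of_unity:
  assumes "M > 0"
  shows "(\<Sum>p<M. cis (2 * pi * (of_int k * (real p / real M)))) = (if int M dvd k then of_nat M else 0)"
proof -
  define z where "z = cis (2 * pi * of_int k / real M)"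
  have pw: "cis (2 * pi * (of_int k * (real p / real M))) = z ^ p" for p
    unfolding z_def by (simp add: Complex.DeMoivre mult_ac)
  have zM: "z ^ M = 1"
    using assms pw[of M] cis_multiple_2pi[of "of_int k"] by simp
  have z1: "z = 1 \<longleftrightarrow> int M dvd k"
  proof
    assume "int M dvd k"
    then obtain j where "k = int M * j" by auto
    then show "z = 1" unfolding z_def using assms cis_multiple_2pi[of "of_int j"] by (simp add: mult.assoc)
  next
    assume "z = 1"
    then have "cos (2 * pi * of_int k / real M) = 1"
      unfolding z_def by (metis cis.simps(1) one_complex.simps(1))
    then obtain j :: int where "2 * pi * of_int k / real M = of_int j * 2 * pi"
      using cos_one_2pi_int by blast
    then have "real_of_int k = of_int j * real M" using assms by (simp add: field_simps)
    then have "k = j * int M" by (metis of_int_eq_iff of_int_mult of_int_of_nat_eq)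
    then show "int M dvd k" by simp
  qed
  show ?thesis
  proof (cases "z = 1")
    case True
    then show ?thesis using z1 unfolding pw by simp
  next
    case False
    then show ?thesis using z1 zM unfolding pw by (simp add: geometric_sum)
  qed
qed

text \<open>\<open>C\<close> is the constant Fourier coefficient. It is chosen before
  \<open>M\<close>: one value serves every grid that is fine enough not to alias a nonzero frequency
  of \<open>F\<close> to zero.\<close>

lemma trig_poly_grid_sum:
  assumes "trig_poly N F"
  shows "\<exists>C. \<forall>M. N < 2 * M \<longrightarrow>
           (\<Sum>p<M. \<Sum>q<M. F (real p / real M, real q / real M)) = C * of_nat M ^ 2"
  using assms
proof (induction rule: trig_poly.induct)
  case (expo k l)
  have "(\<Sum>p<M. \<Sum>q<M. expo k l (real p / real M, real q / real M))
      = (if k = 0 \<and> l = 0 then 1 else 0) * of_nat M ^ 2" if M: "N < 2 * M" for M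
  proof -
    have "M > 0" using M by auto
    have dv: "int M dvd k \<and> int M dvd l \<longleftrightarrow> k = 0 \<and> l = 0"
    proof
      assume "int M dvd k \<and> int M dvd l"
      then obtain a b where ab: "k = int M * a" "l = int M * b" by (auto elim!: dvdE)
      have small: "\<bar>x\<bar> \<le> 1" if "\<bar>int M * x\<bar> \<le> int N" for x
      proof (rule ccontr)
        assume "\<not> \<bar>x\<bar> \<le> 1"
        then have "int M * 2 \<le> int M * \<bar>x\<bar>" by (intro mult_left_mono) auto
        also have "\<dots> \<le> int N" using that by (simp add: abs_mult)
        finally show False using M by simp
      qed
      have "\<bar>2 * a - b\<bar> \<le> 1" "\<bar>2 * b - a\<bar> \<le> 1" "\<bar>a + b\<bar> \<le> 1"
        using expo by (auto intro!: small simp: ab algebra_simps)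
      \<comment> \<open>\<open>2 * a - b\<close> and \<open>2 * b - a\<close> differ by a multiple
        of 3 and both lie between -1 and 1, so they agree. Hence \<open>a = b\<close>, and
        \<open>\<bar>a + b\<bar> \<le> 1\<close> leaves only 0.\<close>
      then have "a = 0 \<and> b = 0" by presburger
      then show "k = 0 \<and> l = 0" using ab by simp
    qed simp
    have "(\<Sum>p<M. \<Sum>q<M. expo k l (real p / real M, real q / real M))
        = (\<Sum>p<M. cis (2 * pi * (of_int k * (real p / real M))))
          * (\<Sum>q<M. cis (2 * pi * (of_int l * (real q / real M))))"
      by (simp add: sum_product expo_def cis_mult algebra_simps)
    then show ?thesis
      unfolding sum_roots_of_unity[OF \<open>M > 0\<close>] using dv by (auto simp: power2_eq_square)
  qed
  then show ?case by blast
next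
  case (add F G)
  then obtain C D where
    "\<forall>M. N < 2 * M \<longrightarrow> (\<Sum>p<M. \<Sum>q<M. F (real p / real M, real q / real M)) = C * of_nat M ^ 2"
    "\<forall>M. N < 2 * M \<longrightarrow> (\<Sum>p<M. \<Sum>q<M. G (real p / real M, real q / real M)) = D * of_nat M ^ 2"
    by blast
  then show ?case by (intro exI[of _ "C + D"]) (simp add: sum.distrib algebra_simps)
next
  case (scale F c)
  then obtain C where
    "\<forall>M. N < 2 * M \<longrightarrow> (\<Sum>p<M. \<Sum>q<M. F (real p / real M, real q / real M)) = C * of_nat M ^ 2"
    by blast
  then show ?case by (intro exI[of _ "c * C"]) (simp flip: sum_distrib_left)
qed

lemma continuous_trig_poly: "trig_poly N F \<Longrightarrow> continuous_on UNIV F"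
  by (induction rule: trig_poly.induct) (auto simp: expo_def[abs_def] cis_conv_exp intro!: continuous_on_add continuous_on_mult continuous_intros)

section \<open>Cubature on the alcove\<close>

text \<open>The last inequality says \<open>q < M - p - q\<close>: the coordinates \<open>p\<close>,
  \<open>q\<close> and \<open>M - p - q\<close>, with sum \<open>M\<close>, are positive and
  strictly increasing.\<close>

definition alcove_nodes :: "nat \<Rightarrow> (int \<times> int) set" where
  "alcove_nodes M = {(p, q). 0 < p \<and> p < q \<and> p + 2 * q < int M}"

lemma finite_alcove_nodes: "finite (alcove_nodes M)"
proof (rule finite_subset)
  show "alcove_nodes M \<subseteq> {0..int M} \<times> {0..int M}" by (auto simp: alcove_nodes_def)
qed auto

text \<open>The walls contribute nothing and cut the grid into twelve cells: the triangles
  \<open>B\<close> and \<open>B'\<close> are exchanged by \<open>neg\<close>, and each consists of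
  six cells, one for each order of \<open>p\<close>, \<open>q\<close> and
  \<open>M - p - q\<close>.\<close>

lemma symmetric_grid_sum:
  fixes h :: "int \<times> int \<Rightarrow> real"
  assumes swap: "\<And>p q. h (q, p) = h (p, q)"
    and shear: "\<And>p q. h (int M - p - q, q) = h (p, q)"
    and neg: "\<And>p q. h (int M - p, int M - q) = h (p, q)"
    and zero: "\<And>q. h (0, q) = 0" and diag: "\<And>p. h (p, p) = 0"
  shows "(\<Sum>p<M. \<Sum>q<M. h (int p, int q)) = 12 * sum h (alcove_nodes M)"
proof -
  define A where "A = {0..<int M} \<times> {0..<int M}"
  define B where "B = {(p, q). 0 < p \<and> 0 < q \<and> p + q < int M}"
  define B' where "B' = {(p, q). p < int M \<and> q < int M \<and> int M < p + q}"
  define U where "U = {(p, q). 0 < p \<and> p < q \<and> p + q < int M}"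
  define V where "V = {(p, q). 0 < q \<and> q < p \<and> p + q < int M}"
  define W1 where "W1 = {(p, q). 0 < p \<and> p < int M - p - q \<and> int M - p - q < q}"
  define W2 where "W2 = {(p, q). 0 < int M - p - q \<and> int M - p - q < p \<and> p < q}"
  note defs = A_def B_def B'_def U_def V_def W1_def W2_def alcove_nodes_def
  have fin: "finite A" "finite B" "finite B'" "finite U" "finite V" "finite W1" "finite W2"
    by (rule finite_subset[of _ "{0..int M} \<times> {0..int M}"]; auto simp: defs)+
  have zero': "h (p, 0) = 0" for p using zero swap by metis
  have zero'': "h (p, q) = 0" if "p + q = int M" for p q
    using shear[of p q] zero that by (simp add: algebra_simps)
  \<comment> \<open>With r for \<open>M - p - q\<close>, \<open>shear\<close> exchanges p and r.
    Together with \<open>swap\<close> it yields all permutations of (p, q, r).\<close>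
  have shear': "h (p, int M - (p + q)) = h (p, q)" for p q
    using shear[of q p] swap by (metis add.commute diff_diff_eq)
  have shear'': "h (int M - (p + q), p) = h (p, q)" for p q
    using shear[of q p] swap by (metis add.commute diff_diff_eq)
  have "(\<Sum>p<M. \<Sum>q<M. h (int p, int q)) = sum h A"
    unfolding A_def sum.cartesian_product
    by (rule sum.reindex_bij_witness[of _ "\<lambda>(p, q). (nat p, nat q)" "\<lambda>(p, q). (int p, int q)"]) auto
  also have "\<dots> = sum h (B \<union> B')"
    proof (rule sum.mono_neutral_right)
      show "\<forall>i\<in>A - (B \<union> B'). h i = 0"
      proof
        fix i assume "i \<in> A - (B \<union> B')"
        moreover obtain p q where i: "i = (p, q)" by (cases i)
        ultimately have "p = 0 \<or> q = 0 \<or> p + q = int M" by (auto simp: defs)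
        then show "h i = 0" unfolding i using zero zero' zero'' by metis
      qed
    qed (use fin in \<open>auto simp: defs\<close>)
  also have "\<dots> = sum h B + sum h B'"
    using fin by (intro sum.union_disjoint) (auto simp: defs)
  also have "sum h B' = sum h B"
    by (rule sum.reindex_bij_witness[of _ "\<lambda>(p, q). (int M - p, int M - q)" "\<lambda>(p, q). (int M - p, int M - q)"])
       (auto simp: defs neg)
  also have "sum h B = sum h (U \<union> V)"
  proof (rule sum.mono_neutral_right)
    show "\<forall>i\<in>B - (U \<union> V). h i = 0"
    proof
      fix i assume "i \<in> B - (U \<union> V)"
      moreover obtain p q where i: "i = (p, q)" by (cases i)
      ultimately have "p = q" by (auto simp: defs)
      then show "h i = 0" using i diag by simp
    qed
  qed (use fin in \<open>auto simp: defs\<close>)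
  also have "\<dots> = sum h U + sum h V"
    using fin by (intro sum.union_disjoint) (auto simp: defs)
  also have "sum h V = sum h U"
    by (rule sum.reindex_bij_witness[of _ "\<lambda>(p, q). (q, p)" "\<lambda>(p, q). (q, p)"])
       (auto simp: defs swap)
  \<comment> \<open>On \<open>U\<close> the order \<open>p < q\<close> is fixed. The third
    coordinate lies above both (\<open>alcove_nodes\<close>), between them (\<open>W1\<close>) or
    below both (\<open>W2\<close>), up to walls.\<close>
  also have "sum h U = sum h (alcove_nodes M \<union> (W1 \<union> W2))"
  proof (rule sum.mono_neutral_right)
    show "\<forall>i\<in>U - (alcove_nodes M \<union> (W1 \<union> W2)). h i = 0"
    proof
      fix i assume "i \<in> U - (alcove_nodes M \<union> (W1 \<union> W2))"
      moreover obtain p q where i: "i = (p, q)" by (cases i)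
      ultimately have "p = int M - p - q \<or> q = int M - p - q" by (auto simp: defs)
      then have "int M - q - p = p \<or> int M - p - q = q" by linarith
      then show "h i = 0"
        unfolding i using shear[of p q] shear[of q p] swap[of p q] diag[of p] diag[of q] by metis
    qed
  qed (use fin in \<open>auto simp: defs\<close>)
  also have "\<dots> = sum h (alcove_nodes M) + sum h (W1 \<union> W2)"
    using fin finite_alcove_nodes by (intro sum.union_disjoint) (auto simp: defs)
  also have "sum h (W1 \<union> W2) = sum h W1 + sum h W2"
    using fin by (intro sum.union_disjoint) (auto simp: defs)
  also have "sum h W1 = sum h (alcove_nodes M)"
    by (rule sum.reindex_bij_witness[of _ "\<lambda>(p, q). (p, int M - p - q)" "\<lambda>(p, q). (p, int M - p - q)"])
       (auto simp: defs shear' algebra_simps)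
  also have "sum h W2 = sum h (alcove_nodes M)"
    by (rule sum.reindex_bij_witness[of _ "\<lambda>(p, q). (q, int M - p - q)" "\<lambda>(p, q). (int M - p - q, p)"])
       (auto simp: defs shear'' algebra_simps)
  finally show ?thesis by simp
qed


section \<open>Convergence of Riemann sums in the unit square\<close>

lemma tendsto_floor_mult_divide:
  "(\<lambda>M. of_int \<lfloor>real (Suc M) * x\<rfloor> / real (Suc M)) \<longlonglongrightarrow> x"
proof (rule real_tendsto_sandwich)
  show "\<forall>\<^sub>F M in sequentially. x - 1 / real (Suc M) \<le> of_int \<lfloor>real (Suc M) * x\<rfloor> / real (Suc M)"
  proof (rule always_eventually, rule allI)
    fix M
    have "real (Suc M) * x - 1 \<le> of_int \<lfloor>real (Suc M) * x\<rfloor>" by linarith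
    then have "(real (Suc M) * x - 1) / real (Suc M) \<le> of_int \<lfloor>real (Suc M) * x\<rfloor> / real (Suc M)"
      by (intro divide_right_mono) auto
    then show "x - 1 / real (Suc M) \<le> of_int \<lfloor>real (Suc M) * x\<rfloor> / real (Suc M)"
      by (simp only: diff_divide_distrib) simp
  qed
  show "\<forall>\<^sub>F M in sequentially. of_int \<lfloor>real (Suc M) * x\<rfloor> / real (Suc M) \<le> x"
  proof (rule always_eventually, rule allI)
    fix M
    show "of_int \<lfloor>real (Suc M) * x\<rfloor> / real (Suc M) \<le> x"
      using of_int_floor_le[of "real (Suc M) * x"] by (simp add: divide_le_eq mult.commute)
  qed
  show "(\<lambda>M. x - 1 / real (Suc M)) \<longlonglongrightarrow> x"
    using tendsto_diff[OF tendsto_const LIMSEQ_inverse_real_of_nat, of x]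
    by (simp add: inverse_eq_divide)
qed simp

text \<open>The sum is the integral of \<open>G\<close> composed with rounding down to the grid,
  which tends to \<open>G\<close> pointwise by continuity and is dominated. The index
  \<open>Suc M\<close> is included because \<open>G\<close> need not vanish where a coordinate is
  1.\<close>

lemma riemann_sum_tendsto:
  fixes G :: "real \<times> real \<Rightarrow> real"
  assumes cont: "continuous_on UNIV G"
    and supp: "\<And>x y. \<not> (0 \<le> x \<and> x \<le> 1 \<and> 0 \<le> y \<and> y \<le> 1) \<Longrightarrow> G (x, y) = 0"
  shows "(\<lambda>M. (\<Sum>p\<le>Suc M. \<Sum>q\<le>Suc M. G (real p / real (Suc M), real q / real (Suc M))) / real (Suc M) ^ 2)
           \<longlonglongrightarrow> (LINT s|lborel. G s)"
proof -
  define \<phi> where "\<phi> M x = of_int \<lfloor>real (Suc M) * x\<rfloor> / real (Suc M)" for M x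
  define I where "I M p = {real p / real (Suc M)..<(real p + 1) / real (Suc M)}" for M p :: nat
  have I_iff: "x \<in> I M p \<longleftrightarrow> \<lfloor>real (Suc M) * x\<rfloor> = int p" for M p x
    unfolding I_def floor_eq_iff by (simp add: field_simps del: of_nat_Suc)
  have step: "G (\<phi> M (fst s), \<phi> M (snd s)) = (\<Sum>p\<le>Suc M. \<Sum>q\<le>Suc M.
      G (real p / real (Suc M), real q / real (Suc M)) * indicator (I M p \<times> I M q) s)" for M s
  proof -
    obtain x y where s: "s = (x, y)" by (cases s)
    define k l where "k = \<lfloor>real (Suc M) * x\<rfloor>" and "l = \<lfloor>real (Suc M) * y\<rfloor>"
    have ind: "(indicator (I M p \<times> I M q) (x, y) :: real) = (if int p = k \<and> int q = l then 1 else 0)" for p q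
      using I_iff[of x M p] I_iff[of y M q] by (auto simp: indicator_def k_def l_def)
    show ?thesis
    proof (cases "0 \<le> k \<and> k \<le> int (Suc M) \<and> 0 \<le> l \<and> l \<le> int (Suc M)")
      case True
      then obtain k' l' where kl: "k = int k'" "l = int l'" "k' \<le> Suc M" "l' \<le> Suc M"
        by (metis nonneg_int_cases of_nat_le_iff)
      have "(\<Sum>p\<le>Suc M. \<Sum>q\<le>Suc M. G (real p / real (Suc M), real q / real (Suc M)) * indicator (I M p \<times> I M q) s)
          = (\<Sum>p\<le>Suc M. if p = k' then \<Sum>q\<le>Suc M. if q = l' then G (real p / real (Suc M), real q / real (Suc M)) else 0 else 0)"
        unfolding s ind kl by (intro sum.cong refl) (auto simp: if_distrib[of "\<lambda>x. _ * x"] simp del: of_nat_Suc sum.atMost_Suc intro!: sum.cong cong: if_cong)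
      also have "\<dots> = G (real k' / real (Suc M), real l' / real (Suc M))"
        using kl(3,4) by (simp only: sum.delta finite_atMost atMost_iff if_True)
      also have "\<dots> = G (\<phi> M x, \<phi> M y)"
        using kl by (simp add: \<phi>_def k_def l_def)
      finally show ?thesis by (simp add: s)
    next
      \<comment> \<open>The rounded point lies outside the unit square, so both sides are 0.\<close>
      case False
      have "(\<Sum>p\<le>Suc M. \<Sum>q\<le>Suc M. G (real p / real (Suc M), real q / real (Suc M)) * indicator (I M p \<times> I M q) s) = 0"
        unfolding s ind using False by (intro sum.neutral ballI) auto
      moreover have "0 \<le> of_int j / real (Suc M) \<and> of_int j / real (Suc M) \<le> 1 \<longleftrightarrow> 0 \<le> j \<and> j \<le> int (Suc M)" for j
        by (simp add: zero_le_divide_iff divide_le_eq_1 del: of_nat_Suc) linarith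
      then have "\<not> (0 \<le> \<phi> M x \<and> \<phi> M x \<le> 1 \<and> 0 \<le> \<phi> M y \<and> \<phi> M y \<le> 1)"
        using False unfolding \<phi>_def k_def[symmetric] l_def[symmetric] by blast
      ultimately show ?thesis using supp by (simp add: s)
    qed
  qed
  have em: "emeasure lborel (I M p \<times> I M q) = ennreal (1 / real (Suc M) ^ 2)" for M p q
  proof -
    have len: "(real p + 1) / real (Suc M) - real p / real (Suc M) = 1 / real (Suc M)" for p
      by (simp add: diff_divide_distrib[symmetric])
    have "emeasure lborel (I M p) = ennreal (1 / real (Suc M))" for p
      unfolding I_def by (subst emeasure_lborel_Ico) (auto simp: len simp del: of_nat_Suc intro!: divide_right_mono)
    then have "emeasure (lborel \<Otimes>\<^sub>M lborel) (I M p \<times> I M q) = ennreal (1 / real (Suc M)) * ennreal (1 / real (Suc M))"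
      by (subst lborel.emeasure_pair_measure_Times) (auto simp: I_def)
    then show ?thesis by (simp add: lborel_prod ennreal_mult'[symmetric] power2_eq_square)
  qed
  have meas: "I M p \<times> I M q \<in> sets lborel" for M p q
    by (simp add: I_def borel_Times)
  have int: "integrable lborel (indicator (I M p \<times> I M q) :: _ \<Rightarrow> real)"
    "integral\<^sup>L lborel (indicator (I M p \<times> I M q) :: _ \<Rightarrow> real) = 1 / real (Suc M) ^ 2" for M p q
    using meas em by (auto intro!: integrable_real_indicator simp: measure_def)
  have eq: "(LINT s|lborel. G (\<phi> M (fst s), \<phi> M (snd s)))
     = (\<Sum>p\<le>Suc M. \<Sum>q\<le>Suc M. G (real p / real (Suc M), real q / real (Suc M))) / real (Suc M) ^ 2" for M
  proof -
    have "(LINT s|lborel. G (\<phi> M (fst s), \<phi> M (snd s)))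
      = (\<Sum>p\<le>Suc M. \<Sum>q\<le>Suc M. G (real p / real (Suc M), real q / real (Suc M)) * (1 / real (Suc M) ^ 2))"
      unfolding step
      by (intro has_bochner_integral_integral_eq has_bochner_integral_sum has_bochner_integral_mult_right)
         (use int in \<open>simp add: has_bochner_integral_iff\<close>)
    then show ?thesis by (simp add: sum_divide_distrib del: sum.atMost_Suc of_nat_Suc)
  qed
  have "compact (G ` ({0..1} \<times> {0..1}))"
    using cont by (intro compact_continuous_image compact_Times compact_Icc) (rule continuous_on_subset, auto)
  then obtain B where B: "\<And>s. s \<in> {0..1} \<times> {0..1} \<Longrightarrow> norm (G s) \<le> B"
    by (meson bounded_iff compact_imp_bounded imageI)
  have B': "norm (G s) \<le> max 0 B" for s
    using B[of s] supp[of "fst s" "snd s"] by (cases "s \<in> {0..1} \<times> {0..1}") (auto simp: mem_Times_iff)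
  have "(\<lambda>M. LINT s|lborel. G (\<phi> M (fst s), \<phi> M (snd s))) \<longlonglongrightarrow> (LINT s|lborel. G s)"
  \<comment> \<open>A point that is rounded down into the unit square exceeds it by at most one mesh
    width, hence lies in the square of side 2.\<close>
  proof (rule integral_dominated_convergence[where w = "\<lambda>s. max 0 B * indicator ({0..2} \<times> {0..2}) s"])
    show "G \<in> borel_measurable lborel"
      using cont by (simp add: borel_measurable_continuous_onI)
    show "(\<lambda>s. G (\<phi> M (fst s), \<phi> M (snd s))) \<in> borel_measurable lborel" for M
      unfolding step using meas by measurable
    have "({0..2} \<times> {0..2} :: (real \<times> real) set) = cbox (0, 0) (2, 2)"
      by (simp add: cbox_Pair_eq)
    then show "integrable lborel (\<lambda>s. max 0 B * indicator ({0..2} \<times> {0..2}) (s :: real \<times> real))"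
      using emeasure_lborel_cbox_finite[of "(0, 0)" "(2, 2) :: real \<times> real"]
      by (intro integrable_mult_right integrable_real_indicator) (auto simp: infinity_ennreal_def)
    show "AE s in lborel. (\<lambda>M. G (\<phi> M (fst s), \<phi> M (snd s))) \<longlonglongrightarrow> G s"
    proof (rule AE_I2)
      fix s :: "real \<times> real"
      have "(\<lambda>M. (\<phi> M (fst s), \<phi> M (snd s))) \<longlonglongrightarrow> (fst s, snd s)"
        unfolding \<phi>_def by (intro tendsto_Pair tendsto_floor_mult_divide)
      then have "(\<lambda>M. G (\<phi> M (fst s), \<phi> M (snd s))) \<longlonglongrightarrow> G (fst s, snd s)"
        by (rule continuous_on_tendsto_compose[OF cont]) auto
      then show "(\<lambda>M. G (\<phi> M (fst s), \<phi> M (snd s))) \<longlonglongrightarrow> G s" by simp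
    qed
    show "AE s in lborel. norm (G (\<phi> M (fst s), \<phi> M (snd s))) \<le> max 0 B * indicator ({0..2} \<times> {0..2}) s" for M
    proof (rule AE_I2)
      fix s :: "real \<times> real"
      have range: "0 \<le> x \<and> x \<le> 2" if "0 \<le> \<phi> M x" "\<phi> M x \<le> 1" for x
      proof -
        have "0 \<le> \<lfloor>real (Suc M) * x\<rfloor>"
          using that(1) unfolding \<phi>_def by (simp add: zero_le_divide_iff del: of_nat_Suc)
        then have "0 \<le> real (Suc M) * x" by linarith
        have "of_int \<lfloor>real (Suc M) * x\<rfloor> \<le> real (Suc M)"
          using that(2) unfolding \<phi>_def by (simp add: divide_le_eq_1 del: of_nat_Suc)
        then have "real (Suc M) * x \<le> real (Suc M) + 1" by linarith
        also have "\<dots> \<le> real (Suc M) * 2" by simp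
        finally show ?thesis
          using \<open>0 \<le> real (Suc M) * x\<close> by (simp add: zero_le_mult_iff del: of_nat_Suc)
      qed
      show "norm (G (\<phi> M (fst s), \<phi> M (snd s))) \<le> max 0 B * indicator ({0..2} \<times> {0..2}) s"
      proof (cases "s \<in> {0..2} \<times> {0..2}")
        case True
        then show ?thesis using B' by simp
      next
        case False
        then have "\<not> (0 \<le> \<phi> M (fst s) \<and> \<phi> M (fst s) \<le> 1 \<and> 0 \<le> \<phi> M (snd s) \<and> \<phi> M (snd s) \<le> 1)"
          using range by (auto simp: mem_Times_iff)
        then show ?thesis using supp False by simp
      qed
    qed
  qed
  then show ?thesis by (simp only: eq)
qed

section \<open>Exactness of the node sums on the alcove\<close>

definition alcove :: "(real \<times> real) set" where
  "alcove = {(x, y). 0 \<le> x \<and> x \<le> y \<and> x + 2 * y \<le> 1}"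

lemma compact_alcove: "compact alcove"
proof -
  have "closed alcove"
    unfolding alcove_def case_prod_beta by (intro closed_Collect_conj closed_Collect_le continuous_intros)
  moreover have "alcove \<subseteq> cbox (0, 0) (1, 1)"
    by (auto simp: alcove_def cbox_Pair_eq)
  ultimately show ?thesis
    using bounded_cbox bounded_subset compact_eq_bounded_closed by blast
qed

text \<open>The wall conditions serve twice: they make the extension of \<open>F\<close> by zero
  continuous, and they remove the boundary points from the grid sums. The three symmetries fold the
  full grid onto the alcove.\<close>

lemma alcove_integral:
  fixes F :: "real \<times> real \<Rightarrow> real"
  assumes trig: "trig_poly N (\<lambda>s. of_real (F s))"
    and swap: "\<And>x y. F (y, x) = F (x, y)"
    and shear: "\<And>x y. F (1 - x - y, y) = F (x, y)"
    and neg: "\<And>x y. F (1 - x, 1 - y) = F (x, y)"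
    and zero: "\<And>y. F (0, y) = 0" and diag: "\<And>x. F (x, x) = 0"
    and N: "N < 2 * M"
  shows "(LINT s:alcove|lborel. F s)
       = (\<Sum>(p, q)\<in>alcove_nodes M. F (of_int p / real M, of_int q / real M)) / real M ^ 2"
proof -
  define S where "S M = (\<Sum>(p, q)\<in>alcove_nodes M. F (of_int p / real M, of_int q / real M))" for M
  obtain C :: complex where C: "\<And>M. N < 2 * M \<Longrightarrow>
      (\<Sum>p<M. \<Sum>q<M. of_real (F (real p / real M, real q / real M))) = C * of_nat M ^ 2"
    using trig_poly_grid_sum[OF trig] by blast
  have S: "S M = Re C / 12 * real M ^ 2" if "N < 2 * M" for M
  proof -
    have "M > 0" using that by auto
    define h where "h = (\<lambda>(p, q). F (of_int p / real M, of_int q / real M))"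
    have "(\<Sum>p<M. \<Sum>q<M. h (int p, int q)) = 12 * sum h (alcove_nodes M)"
    proof (rule symmetric_grid_sum)
      fix p q
      show "h (q, p) = h (p, q)" "h (0, q) = 0" "h (p, p) = 0"
        by (simp_all add: h_def swap zero diag)
      have "1 - of_int p / real M - of_int q / real M = of_int (int M - p - q) / real M"
        "1 - of_int p / real M = of_int (int M - p) / real M"
        "1 - of_int q / real M = of_int (int M - q) / real M"
        using \<open>M > 0\<close> by (auto simp: field_simps)
      then show "h (int M - p - q, q) = h (p, q)" "h (int M - p, int M - q) = h (p, q)"
        using shear[of "of_int p / real M" "of_int q / real M"] neg[of "of_int p / real M" "of_int q / real M"]
        by (simp_all only: h_def case_prod_conv)
    qed
    moreover have "(\<Sum>p<M. \<Sum>q<M. h (int p, int q)) = Re (C * of_nat M ^ 2)"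
      unfolding C[OF that, symmetric] by (simp add: h_def)
    moreover have "Re (C * of_nat M ^ 2) = Re C * real M ^ 2"
    proof -
      have "(of_nat M ^ 2 :: complex) = of_real (real M ^ 2)" by simp
      then show ?thesis by (simp only: times_complex.sel Re_complex_of_real Im_complex_of_real mult_zero_right diff_zero)
    qed
    ultimately show ?thesis by (simp add: S_def h_def)
  qed
  define G where "G s = (if s \<in> alcove then F s else 0)" for s
  have contF: "continuous_on A F" for A
  proof -
    have "continuous_on UNIV (\<lambda>s. Re (of_real (F s)))"
      by (rule continuous_on_Re[OF continuous_trig_poly[OF trig]])
    then have "continuous_on UNIV F" by simp
    then show ?thesis by (rule continuous_on_subset) simp
  qed
  have wall: "F (x, y) = 0" if "x = 0 \<or> x = y \<or> x + 2 * y = 1" for x y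
  proof -
    \<comment> \<open>On the third wall \<open>1 - x - y = y\<close>, so \<open>shear\<close>
      carries the point to the diagonal.\<close>
    have "F (x, y) = 0" if "x + 2 * y = 1"
    proof -
      have "1 - x - y = y" using that by simp
      then show ?thesis using diag[of y] shear[of x y] by simp
    qed
    then show ?thesis using that zero diag by auto
  qed
  \<comment> \<open>The closed complement of the open alcove. It meets \<open>alcove\<close> only in
    the walls, where both branches of \<open>G\<close> are 0, so the two pieces paste together
    continuously.\<close>
  define E where "E = {(x, y). \<not> (0 < x \<and> x < y \<and> x + 2 * y < (1 :: real))}"
  have "continuous_on (alcove \<union> E) G"
    unfolding G_def
  proof (rule continuous_on_cases)
    have "E = {s. fst s \<le> 0} \<union> {s. snd s \<le> fst s} \<union> {s. 1 \<le> fst s + 2 * snd s}"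
      by (auto simp: E_def)
    also have "closed \<dots>"
      by (intro closed_Un closed_Collect_le continuous_intros)
    finally show "closed E" .
    show "\<forall>s. s \<in> alcove \<and> s \<notin> alcove \<or> s \<in> E \<and> s \<in> alcove \<longrightarrow> F s = 0"
      by (auto simp: E_def alcove_def intro!: wall)
  qed (use contF compact_alcove compact_imp_closed in auto)
  moreover have "alcove \<union> E = UNIV" by (auto simp: alcove_def E_def)
  ultimately have contG: "continuous_on UNIV G" by simp
  have "(\<lambda>M. (\<Sum>p\<le>Suc M. \<Sum>q\<le>Suc M. G (real p / real (Suc M), real q / real (Suc M))) / real (Suc M) ^ 2)
           \<longlonglongrightarrow> (LINT s|lborel. G s)"
    by (rule riemann_sum_tendsto[OF contG]) (auto simp: G_def alcove_def)
  moreover have "(\<Sum>p\<le>M. \<Sum>q\<le>M. G (real p / real M, real q / real M)) = S M" if "M > 0" for M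
  proof -
    let ?h = "\<lambda>(p, q). F (of_int p / real M, of_int q / real M)"
    have mem: "(of_int p / real M, of_int q / real M) \<in> alcove \<longleftrightarrow> 0 \<le> p \<and> p \<le> q \<and> p + 2 * q \<le> int M" for p q
    proof -
      have "of_int p / real M + 2 * (of_int q / real M) = of_int (p + 2 * q) / real M"
        by (simp add: add_divide_distrib)
      then have "of_int p / real M + 2 * (of_int q / real M) \<le> 1 \<longleftrightarrow> of_int (p + 2 * q) \<le> real M"
        using \<open>M > 0\<close> by (simp only: divide_le_eq_1) simp
      also have "\<dots> \<longleftrightarrow> p + 2 * q \<le> int M"
        by (metis of_int_le_iff of_int_of_nat_eq)
      finally show ?thesis
        using \<open>M > 0\<close> by (simp add: alcove_def zero_le_divide_iff divide_le_cancel)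
    qed
    have "(\<Sum>p\<le>M. \<Sum>q\<le>M. G (real p / real M, real q / real M))
        = (\<Sum>(p, q)\<in>{0..int M} \<times> {0..int M}. G (of_int p / real M, of_int q / real M))"
      unfolding sum.cartesian_product
      by (rule sum.reindex_bij_witness[of _ "\<lambda>(p, q). (nat p, nat q)" "\<lambda>(p, q). (int p, int q)"]) auto
    also have "\<dots> = (\<Sum>i\<in>{0..int M} \<times> {0..int M}. if 0 \<le> fst i \<and> fst i \<le> snd i \<and> fst i + 2 * snd i \<le> int M then ?h i else 0)"
      by (intro sum.cong refl) (auto simp: G_def mem)
    also have "\<dots> = sum ?h {i \<in> {0..int M} \<times> {0..int M}. 0 \<le> fst i \<and> fst i \<le> snd i \<and> fst i + 2 * snd i \<le> int M}"
      by (rule sum.inter_filter[symmetric]) simp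
    also have "\<dots> = S M"
      unfolding S_def
    proof (rule sum.mono_neutral_right, simp, force simp: alcove_nodes_def, intro ballI)
      fix i assume "i \<in> {i \<in> {0..int M} \<times> {0..int M}. 0 \<le> fst i \<and> fst i \<le> snd i \<and> fst i + 2 * snd i \<le> int M} - alcove_nodes M"
      moreover obtain p q where i: "i = (p, q)" by (cases i)
      ultimately have "p = 0 \<or> p = q \<or> p + 2 * q = int M" by (auto simp: alcove_nodes_def)
      then have "real_of_int p / real M = 0 \<or> real_of_int p / real M = of_int q / real M \<or>
          of_int p / real M + 2 * (of_int q / real M) = 1"
      proof (elim disjE)
        assume "p + 2 * q = int M"
        then have "of_int p + 2 * of_int q = real M" by (metis of_int_add of_int_mult of_int_numeral of_int_of_nat_eq)
        then show ?thesis using \<open>M > 0\<close> by (simp add: field_simps)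
      qed auto
      then show "?h i = 0" using wall by (simp add: i)
    qed
    finally show ?thesis .
  qed
  ultimately have "(\<lambda>M. S (Suc M) / real (Suc M) ^ 2) \<longlonglongrightarrow> (LINT s|lborel. G s)"
    by (simp only: zero_less_Suc)
  \<comment> \<open>The sequence is constant from index \<open>N\<close> on, since then
    \<open>N < 2 * Suc M\<close>.\<close>
  moreover have "(\<lambda>M. S (Suc M) / real (Suc M) ^ 2) \<longlonglongrightarrow> Re C / 12"
  proof (rule tendsto_eventually)
    show "\<forall>\<^sub>F M in sequentially. S (Suc M) / real (Suc M) ^ 2 = Re C / 12"
      unfolding eventually_sequentially by (intro exI[of _ N] allI impI, subst S) auto
  qed
  ultimately have "(LINT s|lborel. G s) = Re C / 12"
    by (rule LIMSEQ_unique)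
  moreover have "(LINT s:alcove|lborel. F s) = (LINT s|lborel. G s)"
    unfolding set_lebesgue_integral_def G_def by (intro Bochner_Integration.integral_cong) auto
  moreover have "S M / real M ^ 2 = Re C / 12"
    using S[OF N] N by simp
  ultimately show ?thesis by (simp only: S_def)
qed


section \<open>Change of variables in the plane\<close>

text \<open>The library has the change of variables only for \<open>real ^ 'n\<close>, which is therefore identified with \<open>real \<times> real\<close> here.\<close>

lemma distr_lborel_vec2:
  "distr (lborel :: (real ^ 2) measure) borel (\<lambda>v. (v $ 1, v $ 2)) = lborel"
proof (rule lborel_eqI[symmetric])
  fix l u :: "real \<times> real"
  assume lu: "\<And>b. b \<in> Basis \<Longrightarrow> l \<bullet> b \<le> u \<bullet> b"
  define T :: "real \<times> real \<Rightarrow> real ^ 2" where "T p = (\<chi> i. if i = 1 then fst p else snd p)" for p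
  have [measurable]: "(\<lambda>v :: real ^ 2. (v $ 1, v $ 2)) \<in> borel \<rightarrow>\<^sub>M borel"
    by (intro borel_measurable_continuous_onI continuous_intros)
  have le: "fst l \<le> fst u" "snd l \<le> snd u"
    using lu[of "(1, 0)"] lu[of "(0, 1)"] by (auto simp: Basis_prod_def inner_prod_def)
  have pre: "(\<lambda>v :: real ^ 2. (v $ 1, v $ 2)) -` box l u = box (T l) (T u :: real ^ 2)"
    by (auto simp: box_def T_def Basis_vec_def inner_axis inner_prod_def Basis_prod_def forall_2)
  have "emeasure (distr lborel borel (\<lambda>v :: real ^ 2. (v $ 1, v $ 2))) (box l u) = emeasure lborel (box (T l) (T u :: real ^ 2))"
    by (subst emeasure_distr) (simp_all add: pre)
  also have "\<dots> = (\<Prod>b\<in>Basis. (T u - T l) \<bullet> b)"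
    by (rule emeasure_lborel_box) (use le in \<open>auto simp: T_def Basis_vec_def inner_axis\<close>)
  also have "(\<Prod>b\<in>Basis. (T u - T l :: real ^ 2) \<bullet> b) = (fst u - fst l) * (snd u - snd l)"
  proof -
    have "axis 1 (1 :: real) \<noteq> (axis 2 1 :: real ^ 2)" by (simp add: axis_eq_axis)
    then show ?thesis
      by (simp add: Basis_vec_def UNIV_2 T_def inner_axis)
  qed
  also have "\<dots> = (\<Prod>b\<in>Basis. (u - l) \<bullet> b)"
    by (simp add: Basis_prod_def inner_prod_def prod.union_disjoint)
  finally show "emeasure (distr lborel borel (\<lambda>v :: real ^ 2. (v $ 1, v $ 2))) (box l u) = ennreal (\<Prod>b\<in>Basis. (u - l) \<bullet> b)" .
qed simp

text \<open>The measure is pushed forward along the coordinate map and then completed; completion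
  does not change integrals of Borel functions.\<close>

lemma set_integral_vec2:
  fixes f :: "real \<times> real \<Rightarrow> real"
  assumes "set_borel_measurable borel S f"
  shows "set_integrable lborel S f \<longleftrightarrow>
           (\<lambda>v :: real ^ 2. f (v $ 1, v $ 2)) absolutely_integrable_on {v. (v $ 1, v $ 2) \<in> S}"
    and "(LINT s:S|lborel. f s) = (LINT v:{v :: real ^ 2. (v $ 1, v $ 2) \<in> S}|lebesgue. f (v $ 1, v $ 2))"
proof -
  let ?T = "\<lambda>v :: real ^ 2. (v $ 1, v $ 2)"
  let ?h = "\<lambda>s. indicator S s *\<^sub>R f s"
  have T: "?T \<in> lborel \<rightarrow>\<^sub>M borel"
    by (simp add: borel_measurable_continuous_onI continuous_intros)
  have h: "?h \<in> borel_measurable borel"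
    using assms by (simp add: set_borel_measurable_def)
  have hT: "(\<lambda>v. ?h (?T v)) \<in> borel_measurable lborel"
    using measurable_compose[OF T h] by simp
  have ind: "indicator {v. ?T v \<in> S} v = (indicator S (?T v) :: real)" for v
    by (simp add: indicator_def)
  have "integrable lborel ?h \<longleftrightarrow> integrable (distr lborel borel ?T) ?h"
    by (simp only: distr_lborel_vec2)
  also have "\<dots> \<longleftrightarrow> integrable lborel (\<lambda>v. ?h (?T v))"
    by (rule integrable_distr_eq[OF T h])
  also have "\<dots> \<longleftrightarrow> integrable lebesgue (\<lambda>v. ?h (?T v))"
    by (rule integrable_completion[OF hT, symmetric])
  finally show "set_integrable lborel S f \<longleftrightarrow> (\<lambda>v. f (?T v)) absolutely_integrable_on {v. ?T v \<in> S}"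
    by (simp only: set_integrable_def ind)
  have "integral\<^sup>L lborel ?h = integral\<^sup>L (distr lborel borel ?T) ?h"
    by (simp only: distr_lborel_vec2)
  also have "\<dots> = integral\<^sup>L lborel (\<lambda>v. ?h (?T v))"
    by (rule integral_distr[OF T h])
  also have "\<dots> = integral\<^sup>L lebesgue (\<lambda>v. ?h (?T v))"
    by (rule integral_completion[OF hT, symmetric])
  finally show "(LINT s:S|lborel. f s) = (LINT v:{v. ?T v \<in> S}|lebesgue. f (?T v))"
    by (simp only: set_lebesgue_integral_def ind)
qed

text \<open>The map is conjugated to \<open>real ^ 2\<close> by \<open>R\<close> and
  \<open>?T\<close>. Integrability on the image is a conclusion here, drawn from that of the
  pullback.\<close>

lemma change_of_variables_plane:
  fixes g1 g2 f :: "real \<times> real \<Rightarrow> real"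
  assumes S: "compact S" and inj: "inj_on (\<lambda>s. (g1 s, g2 s)) S"
    and d1: "\<And>s. (g1 has_derivative (\<lambda>h. a1 s * fst h + b1 s * snd h)) (at s)"
    and d2: "\<And>s. (g2 has_derivative (\<lambda>h. a2 s * fst h + b2 s * snd h)) (at s)"
    and f: "f \<in> borel_measurable borel"
    and int: "set_integrable lborel S (\<lambda>s. \<bar>a1 s * b2 s - b1 s * a2 s\<bar> * f (g1 s, g2 s))"
  shows "set_integrable lborel ((\<lambda>s. (g1 s, g2 s)) ` S) f"
    and "(LINT p:(\<lambda>s. (g1 s, g2 s)) ` S|lborel. f p)
       = (LINT s:S|lborel. \<bar>a1 s * b2 s - b1 s * a2 s\<bar> * f (g1 s, g2 s))"
proof -
  let ?T = "\<lambda>v :: real ^ 2. (v $ 1, v $ 2)"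
  let ?g = "\<lambda>s. (g1 s, g2 s)"
  let ?J = "\<lambda>s. \<bar>a1 s * b2 s - b1 s * a2 s\<bar>"
  define R :: "real \<times> real \<Rightarrow> real ^ 2" where "R p = (\<chi> i. if i = 1 then fst p else snd p)" for p
  have TR [simp]: "R p $ 1 = fst p" "R p $ 2 = snd p" for p by (simp_all add: R_def)
  have RT: "R (?T v) = v" for v by (simp add: vec_eq_iff forall_2)
  define S' where "S' = {v. ?T v \<in> S}"
  define G where "G v = R (?g (?T v))" for v
  define G' where "G' v h = R (a1 (?T v) * h $ 1 + b1 (?T v) * h $ 2, a2 (?T v) * h $ 1 + b2 (?T v) * h $ 2)" for v h :: "real ^ 2"
  have det: "\<bar>det (matrix (G' v))\<bar> = ?J (?T v)" for v
    by (simp add: det_2 matrix_def G'_def axis_def)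
  have TdG: "(?T has_derivative ?T) (at v within S')" for v
    by (intro has_derivative_Pair bounded_linear_imp_has_derivative bounded_linear_vec_nth)
  have dG: "(G has_derivative G' v) (at v within S')" for v
  proof (subst has_derivative_componentwise_within, intro ballI)
    fix b :: "real ^ 2" assume "b \<in> Basis"
    then obtain i where b: "b = axis i 1" by (auto simp: Basis_vec_def)
    have "((\<lambda>v. g1 (?T v)) has_derivative (\<lambda>h. a1 (?T v) * h $ 1 + b1 (?T v) * h $ 2)) (at v within S')"
      using has_derivative_compose[OF TdG d1] by simp
    moreover have "((\<lambda>v. g2 (?T v)) has_derivative (\<lambda>h. a2 (?T v) * h $ 1 + b2 (?T v) * h $ 2)) (at v within S')"
      using has_derivative_compose[OF TdG d2] by simp
    ultimately show "((\<lambda>v. G v \<bullet> b) has_derivative (\<lambda>h. G' v h \<bullet> b)) (at v within S')"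
      using exhaust_2[of i] by (auto simp: b inner_axis G_def G'_def)
  qed
  have injG: "inj_on G S'"
  proof (rule inj_onI)
    fix v w assume *: "v \<in> S'" "w \<in> S'" "G v = G w"
    then have "?g (?T v) = ?g (?T w)" by (metis G_def TR prod.collapse)
    then have "?T v = ?T w" using * inj by (auto simp: S'_def inj_on_def)
    then show "v = w" by (metis RT)
  qed
  have img: "G ` S' = {v. ?T v \<in> ?g ` S}"
  proof (intro set_eqI iffI)
    fix v assume "v \<in> {v. ?T v \<in> ?g ` S}"
    then obtain s where s: "s \<in> S" "?T v = ?g s" by auto
    have "?T (R s) = s" by simp
    then have "R s \<in> S'" "G (R s) = v"
      using s RT[of v] by (simp_all only: S'_def G_def mem_Collect_eq)
    then show "v \<in> G ` S'" by blast
  qed (auto simp: G_def S'_def)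
  have contg: "continuous_on S ?g"
    by (intro continuous_on_Pair has_derivative_continuous_on[OF has_derivative_at_withinI[OF d1]]
        has_derivative_continuous_on[OF has_derivative_at_withinI[OF d2]])
  have "S \<in> sets borel" using S by (simp add: compact_imp_closed)
  have gS: "?g ` S \<in> sets borel"
    using compact_continuous_image[OF contg S] by (simp add: compact_imp_closed)
  have "S' \<in> sets borel"
  proof -
    have "?T \<in> borel \<rightarrow>\<^sub>M borel" by (intro borel_measurable_continuous_onI continuous_intros)
    then show ?thesis
      using \<open>S \<in> sets borel\<close> measurable_sets[of ?T borel borel S] by (simp add: S'_def vimage_def)
  qed
  then have S': "S' \<in> sets lebesgue" by simp
  have mJ: "set_borel_measurable borel S (\<lambda>s. ?J s * f (?g s))"
    using int by (simp add: set_integrable_def set_borel_measurable_def borel_measurable_integrable)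
  have mf: "set_borel_measurable borel (?g ` S) f"
    using f gS by (simp add: set_borel_measurable_def)
  have int': "(\<lambda>v. ?J (?T v) * f (?g (?T v))) absolutely_integrable_on S'"
    using int set_integral_vec2(1)[OF mJ] by (simp add: S'_def)
  have fG: "f (?T (G v)) = f (?g (?T v))" for v by (simp add: G_def)
  \<comment> \<open>The change of variables theorem takes vector-valued integrands, so real values
    are wrapped in \<open>real ^ 1\<close>.\<close>
  have "(\<lambda>v. \<bar>det (matrix (G' v))\<bar> *\<^sub>R (vec (f (?T (G v))) :: real ^ 1)) absolutely_integrable_on S' \<and>
      integral S' (\<lambda>v. \<bar>det (matrix (G' v))\<bar> *\<^sub>R (vec (f (?T (G v))) :: real ^ 1))
        = vec (integral S' (\<lambda>v. ?J (?T v) * f (?g (?T v))))"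
    using int' by (simp add: det fG absolutely_integrable_on_1_iff integral_on_1_eq)
  then have "(\<lambda>v. vec (f (?T v)) :: real ^ 1) absolutely_integrable_on (G ` S') \<and>
      integral (G ` S') (\<lambda>v. vec (f (?T v)) :: real ^ 1)
        = vec (integral S' (\<lambda>v. ?J (?T v) * f (?g (?T v))))"
    by (subst (asm) has_absolute_integral_change_of_variables[OF S' dG injG])
  then have *: "(\<lambda>v. f (?T v)) absolutely_integrable_on {v. ?T v \<in> ?g ` S}"
    "integral {v. ?T v \<in> ?g ` S} (\<lambda>v. f (?T v)) = integral S' (\<lambda>v. ?J (?T v) * f (?g (?T v)))"
    by (simp_all add: absolutely_integrable_on_1_iff integral_on_1_eq img)
  then show "set_integrable lborel (?g ` S) f"
    using set_integral_vec2(1)[OF mf] by simp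
  show "(LINT p:?g ` S|lborel. f p) = (LINT s:S|lborel. ?J s * f (?g s))"
    using *(2) set_lebesgue_integral_eq_integral(2)[OF *(1)] set_lebesgue_integral_eq_integral(2)[OF int']
    by (simp add: set_integral_vec2(2)[OF mf] set_integral_vec2(2)[OF mJ] S'_def)
qed


section \<open>Deltoid coordinates\<close>

text \<open>
  These are the real and the imaginary part of \<open>z = e\<^sup>i\<^sup>a + e\<^sup>i\<^sup>c + e\<^sup>-\<^sup>i\<^sup>(\<^sup>a\<^sup>+\<^sup>c\<^sup>)\<close>, and the Jacobian of
  \<open>(a, c) \<mapsto> z\<close>, which is also the Vandermonde determinant of the three exponentials up to a factor.
\<close>

definition deltoid_re :: "real \<Rightarrow> real \<Rightarrow> real" where
  "deltoid_re a c = cos a + cos c + cos (a + c)"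
definition deltoid_im :: "real \<Rightarrow> real \<Rightarrow> real" where
  "deltoid_im a c = sin a + sin c - sin (a + c)"
definition vandermonde :: "real \<Rightarrow> real \<Rightarrow> real" where
  "vandermonde a c = sin (c - a) + sin (2 * a + c) - sin (a + 2 * c)"

section \<open>Trigonometric identities behind the weight and \<open>SS\<close>\<close>

lemmas trig_expand = sin_add cos_add sin_diff cos_diff sin_double cos_double

text \<open>The left side is the squared modulus of a sum of three unit numbers; the cosines are
  those of the differences of their angles a, c and -(a + c).\<close>

lemma deltoid_norm:
  "deltoid_re a c ^ 2 + deltoid_im a c ^ 2 = 3 + 2 * (cos (2 * a + c) + cos (c - a) + cos (a + 2 * c))"
  unfolding deltoid_re_def deltoid_im_def trig_expand
  using sin_cos_squared_add3[of a] sin_cos_squared_add3[of c] by algebra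

text \<open>Up to the factor -1/4 the left side is the discriminant of the cubic whose roots are the
  three unit numbers, and a discriminant is the square of a Vandermonde determinant.\<close>

lemma vandermonde_sq:
  fixes a c :: real
  defines "x \<equiv> deltoid_re a c" and "y \<equiv> cos (2 * a + c) + cos (c - a) + cos (a + 2 * c)"
  shows "8 * x ^ 3 - y ^ 2 - 12 * x * y - 18 * x - 12 * y - 9 = vandermonde a c ^ 2"
proof -
  \<comment> \<open>All terms become polynomials in the cosines \<open>C\<close>, \<open>c'\<close>
    and the product \<open>t\<close> of the sines, whose square is again a polynomial in the
    cosines.\<close>
  define C S c' s' t where "C = cos a" "S = sin a" "c' = cos c" "s' = sin c" "t = S * s'"
  note [simp] = C_S_c'_s'_t_def
  define A B where "A = - c' + 2 * C * c' - 2 * c' ^ 2 + 1" "B = C + 2 * C ^ 2 - 1 - 2 * C * c'"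
  have S: "S ^ 2 = 1 - C ^ 2" and s': "s' ^ 2 = 1 - c' ^ 2"
    by (simp_all add: sin_squared_eq)
  have t: "t ^ 2 = (1 - C ^ 2) * (1 - c' ^ 2)"
    unfolding S[symmetric] s'[symmetric] by (simp add: power_mult_distrib)
  have x: "x = C + c' + C * c' - t"
    by (simp add: x_def deltoid_re_def cos_add)
  have y: "y = 2 * C ^ 2 * c' - c' + C * c' + 2 * C * c' ^ 2 - C + t * (1 - 2 * C - 2 * c')"
    unfolding y_def sin_add cos_add sin_diff cos_diff sin_double cos_double_cos
    by (simp add: algebra_simps power2_eq_square)
  have v: "vandermonde a c = S * A + s' * B"
    unfolding vandermonde_def sin_add cos_add sin_diff cos_diff sin_double cos_double_cos
    by (simp add: A_B_def algebra_simps power2_eq_square)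
  have "8 * x ^ 3 - y ^ 2 - 12 * x * y - 18 * x - 12 * y - 9
      = (1 - C ^ 2) * A ^ 2 + (1 - c' ^ 2) * B ^ 2 + 2 * t * A * B"
    unfolding x y A_B_def using t by algebra
  also have "\<dots> = (S * A + s' * B) ^ 2"
    unfolding S[symmetric] s'[symmetric] \<open>t = S * s'\<close>
    by (simp add: power2_eq_square algebra_simps del: C_S_c'_s'_t_def)
  finally show ?thesis by (simp only: v)
qed

text \<open>Here \<open>k1 - k3 = 5\<close> and \<open>k2 = 1\<close>. Product-to-sum formulas turn
  both sides into the same signed sum of six cosines.\<close>

lemma SS_eq:
  "SS (2, 1, -3) (2 * s + t, t - s, - s - 2 * t)
     = deltoid_im (2 * pi * s) (2 * pi * t) * vandermonde (2 * pi * s) (2 * pi * t) / 3"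
proof -
  \<comment> \<open>Half of the deltoid angles: in them every argument of \<open>SS\<close> is an
    integral combination.\<close>
  define a c where "a = pi * s" "c = pi * t"
  have even: "cos (- (a * 6) - c * 4) = cos (a * 6 + c * 4)"
    using cos_minus[of "a * 6 + c * 4"] by simp
  have "SS (2, 1, -3) (2 * s + t, t - s, - s - 2 * t)
    = (1/3) * (sin (5 * (a + c)) * sin (c - a) + sin (- 5 * a) * sin (- a - 2 * c) + sin (- 5 * c) * sin (2 * a + c))"
  proof -
    have "pi * of_int 5 * (2 * s + t - (- s - 2 * t)) / 3 = 5 * (a + c)"
      "pi * of_int 5 * (t - s - (2 * s + t)) / 3 = - 5 * a"
      "pi * of_int 5 * (- s - 2 * t - (t - s)) / 3 = - 5 * c"
      "pi * of_int 1 * (t - s) = c - a" "pi * of_int 1 * (- s - 2 * t) = - a - 2 * c"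
      "pi * of_int 1 * (2 * s + t) = 2 * a + c"
      by (simp_all add: a_c_def field_simps)
    moreover have "(2 - - 3 :: int) = 5" by simp
    ultimately show ?thesis by (simp only: SS_def case_prod_conv)
  qed
  also have "\<dots> = (1/6) * (cos (6 * a + 4 * c) - cos (4 * a + 6 * c) + cos (4 * a - 2 * c) - cos (6 * a + 2 * c)
      + cos (2 * a + 6 * c) - cos (4 * c - 2 * a))"
    by (simp add: sin_times_sin algebra_simps even diff_divide_distrib add_divide_distrib)
  also have "\<dots> = deltoid_im (2 * a) (2 * c) * vandermonde (2 * a) (2 * c) / 3"
    by (simp add: deltoid_im_def vandermonde_def sin_times_sin algebra_simps even diff_divide_distrib add_divide_distrib)
  finally show ?thesis by (simp add: a_c_def mult.assoc)
qed

text \<open>The imaginary part factors into three sines of half angles, all of which lie between 0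
  and \<open>pi\<close>.\<close>

lemma deltoid_im_nonneg:
  assumes "0 \<le> a" "a \<le> c" "a + 2 * c \<le> 2 * pi"
  shows "0 \<le> deltoid_im a c"
proof -
  have "deltoid_im (2 * x) (2 * y) = 4 * sin x * sin y * sin (x + y)" for x y :: real
    unfolding deltoid_im_def distrib_left[symmetric] trig_expand
    using sin_cos_squared_add3[of x] sin_cos_squared_add3[of y] by algebra
  from this[of "a / 2" "c / 2"] have "deltoid_im a c = 4 * sin (a / 2) * sin (c / 2) * sin (a / 2 + c / 2)"
    by simp
  also have "\<dots> \<ge> 0"
    using assms by (intro mult_nonneg_nonneg sin_ge_zero) auto
  finally show ?thesis .
qed

text \<open>
  The three unit numbers are the roots of \<open>X\<^sup>3 - z X\<^sup>2 + z' X - 1\<close>, where \<open>z\<close> is their sum and \<open>z'\<close> its conjugate.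
\<close>

lemma cis_root_of_trace:
  assumes "deltoid_re a c = deltoid_re a' c'" "deltoid_im a c = deltoid_im a' c'"
    and "z \<in> {cis a, cis c, cis (- a - c)}"
  shows "z \<in> {cis a', cis c', cis (- a' - c')}"
proof -
  have poly: "(z - cis p) * (z - cis q) * (z - cis (- p - q))
      = z ^ 3 - Complex (deltoid_re p q) (deltoid_im p q) * z ^ 2 + Complex (deltoid_re p q) (- deltoid_im p q) * z - 1" for p q z
  proof -
    have neg: "cos (- p - q) = cos (p + q)" "sin (- p - q) = - sin (p + q)"
      using cos_minus[of "p + q"] sin_minus[of "p + q"] by simp_all
    have tr: "Complex (deltoid_re p q) (deltoid_im p q) = cis p + cis q + cis (- p - q)"
      "Complex (deltoid_re p q) (- deltoid_im p q) = cis p * cis q + cis p * cis (- p - q) + cis q * cis (- p - q)"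
      by (simp_all add: complex_eq_iff deltoid_re_def deltoid_im_def cis_mult neg)
    have "cis p * cis q * cis (- p - q) = 1" by (simp add: cis_mult)
    then show ?thesis
      unfolding tr by (simp add: algebra_simps power2_eq_square power3_eq_cube)
  qed
  have "(z - cis a) * (z - cis c) * (z - cis (- a - c)) = 0" using assms(3) by auto
  then have "(z - cis a') * (z - cis c') * (z - cis (- a' - c')) = 0"
    unfolding poly assms(1,2) .
  then show ?thesis by auto
qed

text \<open>The trace determines the set of the three unit numbers, and on the alcove their angles
  \<open>a \<le> c \<le> 2 * pi - a - c\<close> are sorted, so the set determines the
  angles.\<close>

lemma deltoid_trace_inj:
  assumes "0 \<le> a" "a \<le> c" "a + 2 * c \<le> 2 * pi" "0 \<le> a'" "a' \<le> c'" "a' + 2 * c' \<le> 2 * pi"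
    and tr: "deltoid_re a c = deltoid_re a' c'" "deltoid_im a c = deltoid_im a' c'"
  shows "a = a' \<and> c = c'"
proof -
  \<comment> \<open>At this vertex the third angle would be \<open>2 * pi\<close>, outside the
    half-open range in which \<open>cis\<close> is injective, so it is treated apart: the real part
    is 3 only there.\<close>
  have origin: "p' = 0 \<and> q' = 0" if "deltoid_re p' q' = deltoid_re 0 0"
    "0 \<le> p'" "p' \<le> q'" "p' + 2 * q' \<le> 2 * pi" for p' q' :: real
  proof -
    have "cos p' + cos q' + cos (p' + q') = 3" using that(1) unfolding deltoid_re_def by simp
    moreover have "cos p' \<le> 1" "cos q' \<le> 1" "cos (p' + q') \<le> 1" by auto
    ultimately have "cos p' = 1" "cos q' = 1" by linarith+
    then have "cos p' = cos 0" "cos q' = cos 0" by simp_all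
    then show ?thesis using that cos_inj_pi[of p' 0] cos_inj_pi[of q' 0] by auto
  qed
  show ?thesis
  proof (cases "a + c = 0 \<or> a' + c' = 0")
    case True
    then show ?thesis
    proof
      assume "a + c = 0"
      then have ac: "a = 0" "c = 0" using assms(1,2) by auto
      then have "deltoid_re a' c' = deltoid_re 0 0" using tr(1) by simp
      from origin[OF this assms(4-6)] ac show ?thesis by simp
    next
      assume "a' + c' = 0"
      then have ac: "a' = 0" "c' = 0" using assms(4,5) by auto
      then have "deltoid_re a c = deltoid_re 0 0" using tr(1) by simp
      from origin[OF this assms(1-3)] ac show ?thesis by simp
    qed
  next
    case False
    have cis_eq: "p = q" if "cis p = cis q" "0 \<le> p" "p < 2 * pi" "0 \<le> q" "q < 2 * pi" for p q
    proof -
      have arg: "Arg2pi (cis r) = r" if "0 \<le> r" "r < 2 * pi" for r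
        using that by (intro Arg2pi_unique[of 1]) (simp_all add: cis_conv_exp mult.commute)
      show ?thesis
        using arg[OF that(2,3)] arg[OF that(4,5)] that(1) by metis
    qed
    define d d' where "d = 2 * pi - a - c" "d' = 2 * pi - a' - c'"
    have cd: "cis (- a - c) = cis d" "cis (- a' - c') = cis d'"
      by (simp_all add: d_d'_def complex_eq_iff cos_diff sin_diff cos_add sin_add)
    have rng: "0 \<le> a" "a \<le> c" "c \<le> d" "d < 2 * pi" "0 \<le> a'" "a' \<le> c'" "c' \<le> d'" "d' < 2 * pi"
      using False assms(1-6) by (auto simp: d_d'_def)
    then have rng': "0 \<le> x \<and> x < 2 * pi" if "x \<in> {a, c, d, a', c', d'}" for x
      using that by (elim insertE; (linarith | simp))
    have sub: "x \<in> {a', c', d'}" if "x \<in> {a, c, d}" for x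
    proof -
      have "cis x \<in> {cis a', cis c', cis d'}"
        using cis_root_of_trace[OF tr, of "cis x"] that unfolding cd by blast
      then show ?thesis using cis_eq[of x] rng' that by blast
    qed
    have sub': "x \<in> {a, c, d}" if "x \<in> {a', c', d'}" for x
    proof -
      have "cis x \<in> {cis a, cis c, cis d}"
        using cis_root_of_trace[OF tr[symmetric], of "cis x"] that unfolding cd by blast
      then show ?thesis using cis_eq[of x] rng' that by blast
    qed
    \<comment> \<open>Sets forget multiplicities, so only the smallest and the largest angles are
      compared; the middle one follows from the sum \<open>2 * pi\<close>.\<close>
    have "a \<in> {a', c', d'}" "d \<in> {a', c', d'}" "a' \<in> {a, c, d}" "d' \<in> {a, c, d}"
      by (rule sub sub', simp)+
    then have "a \<ge> a'" "d \<le> d'" "a' \<ge> a" "d' \<le> d"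
      using rng by auto
    then show ?thesis by (auto simp: d_d'_def)
  qed
qed


section \<open>The cubature rule\<close>

definition alcove_x :: "real \<times> real \<Rightarrow> real" where
  "alcove_x s = deltoid_re (2 * pi * fst s) (2 * pi * snd s) / 3"
definition alcove_y :: "real \<times> real \<Rightarrow> real" where
  "alcove_y s = (deltoid_re (2 * pi * fst s) (2 * pi * snd s) ^ 2
                 + deltoid_im (2 * pi * fst s) (2 * pi * snd s) ^ 2 - 3) / 6"
definition weight_poly1 :: "real \<Rightarrow> real \<Rightarrow> real" where
  "weight_poly1 x y = 1 + 2 * y - 3 * x ^ 2"
definition weight_poly2 :: "real \<Rightarrow> real \<Rightarrow> real" where
  "weight_poly2 x y = 24 * x ^ 3 - y ^ 2 - 12 * x * y - 6 * x - 4 * y - 1"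

lemma alcove_y_cos:
  "alcove_y (s, t) = (cos (2 * pi * (2 * s + t)) + cos (2 * pi * (t - s)) + cos (2 * pi * (s + 2 * t))) / 3"
proof -
  have "2 * pi * (2 * s + t) = 2 * (2 * pi * s) + 2 * pi * t" "2 * pi * (t - s) = 2 * pi * t - 2 * pi * s"
    "2 * pi * (s + 2 * t) = 2 * pi * s + 2 * (2 * pi * t)"
    by (simp_all add: algebra_simps)
  then show ?thesis
    unfolding alcove_y_def fst_conv snd_conv deltoid_norm by simp
qed

lemma alcove_x_cos:
  "alcove_x (s, t) = (cos (2 * pi * s) + cos (2 * pi * t) + cos (2 * pi * (s + t))) / 3"
  by (simp add: alcove_x_def deltoid_re_def algebra_simps)

text \<open>The triple inverts \<open>s = (t1 - t2) / 3\<close>,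
  \<open>t = (t1 + 2 * t2) / 3\<close> on the plane \<open>t1 + t2 + t3 = 0\<close>.\<close>

lemma coord_alcove:
  "x_coord (2 * s + t, t - s, - s - 2 * t) = alcove_x (s, t)"
  "y_coord (2 * s + t, t - s, - s - 2 * t) = alcove_y (s, t)"
proof -
  have "2 * pi * (2 * s + t - (t - s)) / 3 = 2 * pi * s" "2 * pi * (2 * (2 * s + t) + (t - s)) / 3 = 2 * pi * (s + t)"
    "2 * pi * (2 * s + t + 2 * (t - s)) / 3 = 2 * pi * t" "2 * s + t + (t - s) = s + 2 * t"
    by (simp_all add: field_simps)
  then show "x_coord (2 * s + t, t - s, - s - 2 * t) = alcove_x (s, t)"
    "y_coord (2 * s + t, t - s, - s - 2 * t) = alcove_y (s, t)"
    by (simp_all only: x_coord_def y_coord_def alcove_x_cos alcove_y_cos case_prod_conv) simp_all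
qed

lemma tri_star_alcove: "tri_star = (\<lambda>s. (alcove_x s, alcove_y s)) ` alcove"
proof -
  have tri: "tri = (\<lambda>(s, t). (2 * s + t, t - s, - s - 2 * t)) ` alcove"
  proof (intro set_eqI iffI)
    fix r assume "r \<in> tri"
    moreover obtain r1 r2 r3 where r: "r = (r1, r2, r3)" by (cases r)
    ultimately have "((r1 - r2) / 3, (r1 + 2 * r2) / 3) \<in> alcove"
      "r = (\<lambda>(s, t). (2 * s + t, t - s, - s - 2 * t)) ((r1 - r2) / 3, (r1 + 2 * r2) / 3)"
      by (auto simp: tri_def alcove_def field_simps)
    then show "r \<in> (\<lambda>(s, t). (2 * s + t, t - s, - s - 2 * t)) ` alcove" by blast
  qed (auto simp: tri_def alcove_def)
  have "tri_star = (\<lambda>s. (x_coord (case s of (s, t) \<Rightarrow> (2 * s + t, t - s, - s - 2 * t)),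
      y_coord (case s of (s, t) \<Rightarrow> (2 * s + t, t - s, - s - 2 * t)))) ` alcove"
    unfolding tri_star_def tri image_image ..
  also have "\<dots> = (\<lambda>s. (alcove_x s, alcove_y s)) ` alcove"
    by (intro image_cong refl) (simp add: case_prod_beta coord_alcove)
  finally show ?thesis .
qed

text \<open>With z the trace, \<open>1 + 2 * y\<close> is a third of its squared modulus and
  \<open>3 * x ^ 2\<close> a third of its squared real part. The second identity is the discriminant
  formula with both variables scaled by 3.\<close>

lemma weight_poly_alcove:
  "weight_poly1 (alcove_x s) (alcove_y s) = deltoid_im (2 * pi * fst s) (2 * pi * snd s) ^ 2 / 3"
  "weight_poly2 (alcove_x s) (alcove_y s) = vandermonde (2 * pi * fst s) (2 * pi * snd s) ^ 2 / 9"
proof -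
  show "weight_poly1 (alcove_x s) (alcove_y s) = deltoid_im (2 * pi * fst s) (2 * pi * snd s) ^ 2 / 3"
    by (simp add: weight_poly1_def alcove_x_def alcove_y_def power_divide field_simps)
  have x: "deltoid_re (2 * pi * fst s) (2 * pi * snd s) = 3 * alcove_x s"
    by (simp add: alcove_x_def)
  have y: "cos (2 * (2 * pi * fst s) + 2 * pi * snd s) + cos (2 * pi * snd s - 2 * pi * fst s)
      + cos (2 * pi * fst s + 2 * (2 * pi * snd s)) = 3 * alcove_y s"
    unfolding alcove_y_def deltoid_norm by simp
  show "weight_poly2 (alcove_x s) (alcove_y s) = vandermonde (2 * pi * fst s) (2 * pi * snd s) ^ 2 / 9"
    using vandermonde_sq[of "2 * pi * fst s" "2 * pi * snd s"] unfolding x y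
    by (simp add: weight_poly2_def power_mult_distrib)
qed

lemma SS_sq_alcove:
  "SS (2, 1, -3) (2 * s + t, t - s, - s - 2 * t) ^ 2
     = 3 * (weight_poly1 (alcove_x (s, t)) (alcove_y (s, t)) * weight_poly2 (alcove_x (s, t)) (alcove_y (s, t)))"
  unfolding SS_eq weight_poly_alcove by (simp add: power_mult_distrib power_divide)

text \<open>The coordinates give the real part of the trace and the square of its imaginary part;
  nonnegativity on the alcove fixes the sign.\<close>

lemma inj_on_alcove: "inj_on (\<lambda>s. (alcove_x s, alcove_y s)) alcove"
proof (rule inj_onI)
  fix u v assume u: "u \<in> alcove" and v: "v \<in> alcove"
    and eq: "(alcove_x u, alcove_y u) = (alcove_x v, alcove_y v)"
  have angle: "0 \<le> 2 * pi * fst w" "2 * pi * fst w \<le> 2 * pi * snd w"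
    "2 * pi * fst w + 2 * (2 * pi * snd w) \<le> 2 * pi" if "w \<in> alcove" for w
  proof -
    have w: "0 \<le> fst w" "fst w \<le> snd w" "fst w + 2 * snd w \<le> 1"
      using that by (auto simp: alcove_def)
    have "2 * pi * fst w + 2 * (2 * pi * snd w) = 2 * pi * (fst w + 2 * snd w)"
      by (simp add: algebra_simps)
    also have "\<dots> \<le> 2 * pi * 1" using w(3) by (intro mult_left_mono) auto
    finally show "2 * pi * fst w + 2 * (2 * pi * snd w) \<le> 2 * pi" by simp
    show "0 \<le> 2 * pi * fst w" "2 * pi * fst w \<le> 2 * pi * snd w" using w(1,2) by auto
  qed
  have re: "deltoid_re (2 * pi * fst u) (2 * pi * snd u) = deltoid_re (2 * pi * fst v) (2 * pi * snd v)"
    using eq by (simp add: alcove_x_def)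
  have "deltoid_im (2 * pi * fst u) (2 * pi * snd u) ^ 2 = deltoid_im (2 * pi * fst v) (2 * pi * snd v) ^ 2"
    using eq re by (simp add: alcove_y_def)
  then have "deltoid_im (2 * pi * fst u) (2 * pi * snd u) = deltoid_im (2 * pi * fst v) (2 * pi * snd v)"
    using deltoid_im_nonneg[OF angle[OF u]] deltoid_im_nonneg[OF angle[OF v]] by simp
  then have "2 * pi * fst u = 2 * pi * fst v \<and> 2 * pi * snd u = 2 * pi * snd v"
    using deltoid_trace_inj[OF angle[OF u] angle[OF v] re] by simp
  then show "u = v" by (simp add: prod_eq_iff)
qed

text \<open>Chain rule through the trace z = X + iY: the map from (X, Y) to (x, y) has determinant Y
  / 9, and the angles contribute \<open>4 * pi ^ 2\<close> times the Vandermonde factor.\<close>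

lemma alcove_jacobian:
  fixes f :: "real \<times> real \<Rightarrow> real"
  assumes f: "f \<in> borel_measurable borel"
    and int: "set_integrable lborel alcove (\<lambda>s. 4 * pi ^ 2 / 9 * \<bar>deltoid_im (2 * pi * fst s) (2 * pi * snd s)
               * vandermonde (2 * pi * fst s) (2 * pi * snd s)\<bar> * f (alcove_x s, alcove_y s))"
  shows "set_integrable lborel tri_star f"
    and "(LINT p:tri_star|lborel. f p) = (LINT s:alcove|lborel. 4 * pi ^ 2 / 9 *
           \<bar>deltoid_im (2 * pi * fst s) (2 * pi * snd s) * vandermonde (2 * pi * fst s) (2 * pi * snd s)\<bar>
           * f (alcove_x s, alcove_y s))"
proof -
  define a c where "a s = 2 * pi * fst s" "c s = 2 * pi * snd s" for s :: "real \<times> real"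
  define X Y where "X s = deltoid_re (a s) (c s)" "Y s = deltoid_im (a s) (c s)" for s
  define Xa Xc Ya Yc where "Xa s = - sin (a s) - sin (a s + c s)" "Xc s = - sin (c s) - sin (a s + c s)"
    "Ya s = cos (a s) - cos (a s + c s)" "Yc s = cos (c s) - cos (a s + c s)" for s
  define a1 b1 a2 b2 where "a1 s = 2 * pi / 3 * Xa s" "b1 s = 2 * pi / 3 * Xc s"
    "a2 s = 2 * pi / 3 * (X s * Xa s + Y s * Ya s)" "b2 s = 2 * pi / 3 * (X s * Xc s + Y s * Yc s)" for s
  have dX: "(X has_derivative (\<lambda>h. 2 * pi * Xa s * fst h + 2 * pi * Xc s * snd h)) (at s)" for s
    unfolding X_Y_def deltoid_re_def Xa_Xc_Ya_Yc_def a_c_def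
    by (auto intro!: derivative_eq_intros ext simp: algebra_simps)
  have dY: "(Y has_derivative (\<lambda>h. 2 * pi * Ya s * fst h + 2 * pi * Yc s * snd h)) (at s)" for s
    unfolding X_Y_def deltoid_im_def Xa_Xc_Ya_Yc_def a_c_def
    by (auto intro!: derivative_eq_intros ext simp: algebra_simps)
  have xX: "alcove_x = (\<lambda>s. X s / 3)" and yX: "alcove_y = (\<lambda>s. (X s ^ 2 + Y s ^ 2 - 3) / 6)"
    by (simp_all add: fun_eq_iff alcove_x_def alcove_y_def X_Y_def a_c_def)
  have d1: "(alcove_x has_derivative (\<lambda>h. a1 s * fst h + b1 s * snd h)) (at s)" for s
    unfolding xX a1_b1_a2_b2_def
    by (auto intro!: derivative_eq_intros dX ext simp: field_simps)
  have d2: "(alcove_y has_derivative (\<lambda>h. a2 s * fst h + b2 s * snd h)) (at s)" for s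
    unfolding yX a1_b1_a2_b2_def
    by (auto intro!: derivative_eq_intros dX dY ext simp: field_simps)
  have V: "Xa s * Yc s - Xc s * Ya s = vandermonde (a s) (c s)" for s
  proof -
    have "2 * a s + c s = a s + (a s + c s)" "a s + 2 * c s = c s + (a s + c s)" by simp_all
    then have "vandermonde (a s) (c s) = sin (c s - a s) + sin (a s + (a s + c s)) - sin (c s + (a s + c s))"
      by (simp only: vandermonde_def)
    also have "\<dots> = Xa s * Yc s - Xc s * Ya s"
      unfolding sin_diff sin_add[of _ "a s + c s"] Xa_Xc_Ya_Yc_def by (simp add: algebra_simps)
    finally show ?thesis by simp
  qed
  have D: "a1 s * b2 s - b1 s * a2 s = 4 * pi ^ 2 / 9 * (Y s * (Xa s * Yc s - Xc s * Ya s))" for s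
    unfolding a1_b1_a2_b2_def by (simp add: power2_eq_square field_simps)
  have J: "\<bar>a1 s * b2 s - b1 s * a2 s\<bar> = 4 * pi ^ 2 / 9 *
      \<bar>deltoid_im (2 * pi * fst s) (2 * pi * snd s) * vandermonde (2 * pi * fst s) (2 * pi * snd s)\<bar>" for s
    unfolding D V X_Y_def a_c_def by (simp add: abs_mult)
  show "set_integrable lborel tri_star f"
    unfolding tri_star_alcove
    by (rule change_of_variables_plane(1)[OF compact_alcove inj_on_alcove d1 d2 f, unfolded J, OF int])
  show "(LINT p:tri_star|lborel. f p) = (LINT s:alcove|lborel. 4 * pi ^ 2 / 9 *
           \<bar>deltoid_im (2 * pi * fst s) (2 * pi * snd s) * vandermonde (2 * pi * fst s) (2 * pi * snd s)\<bar>
           * f (alcove_x s, alcove_y s))"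
    unfolding tri_star_alcove
    by (rule change_of_variables_plane(2)[OF compact_alcove inj_on_alcove d1 d2 f, unfolded J, OF int])
qed

text \<open>The integrand after the change of variables, up to a constant: one third of the square
  of \<open>SS (2, 1, -3)\<close> times a monomial.\<close>

definition alcove_monom :: "nat \<Rightarrow> nat \<Rightarrow> real \<times> real \<Rightarrow> real" where
  "alcove_monom k l s = weight_poly1 (alcove_x s) (alcove_y s) * weight_poly2 (alcove_x s) (alcove_y s)
     * (alcove_x s ^ k * alcove_y s ^ l)"

text \<open>With exponents 1/2 the weight is a multiple of \<open>\<bar>Y * V\<bar>\<close>, and so
  is the Jacobian. Their product contains only squares, which makes the integrand a trigonometric
  polynomial.\<close>

lemma weight_integral:
  fixes k l :: nat
  defines "g \<equiv> \<lambda>p :: real \<times> real. fst p ^ k * snd p ^ l"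
  shows "set_integrable lborel tri_star (\<lambda>p. weight (1/2) (1/2) p * g p)"
    and "(LINT p:tri_star|lborel. weight (1/2) (1/2) p * g p) = 16 * pi ^ 4 / 9 * (LINT s:alcove|lborel. alcove_monom k l s)"
proof -
  let ?w = "\<lambda>p. weight (1/2) (1/2) p * g p"
  have "weight (1/2) (1/2) = (\<lambda>p. (4 * pi ^ 2) powr (1/2 + 1/2) / 3 powr (2 * (1/2) + 1/2)
      * (1 + 2 * snd p - 3 * fst p ^ 2) powr (1/2)
      * (24 * fst p ^ 3 - snd p ^ 2 - 12 * fst p * snd p - 6 * fst p - 4 * snd p - 1) powr (1/2))"
    by (simp add: weight_def fun_eq_iff)
  also have "\<dots> \<in> borel_measurable borel"
    by (intro borel_measurable_times borel_measurable_const powr_real_measurable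
        borel_measurable_continuous_onI continuous_intros)
  finally have "weight (1/2) (1/2) \<in> borel_measurable borel" .
  moreover have "g \<in> borel_measurable borel"
    unfolding g_def by (intro borel_measurable_continuous_onI continuous_intros)
  ultimately have mw: "?w \<in> borel_measurable borel"
    by (rule borel_measurable_times)
  have "4 * pi ^ 2 / 9 * \<bar>deltoid_im (2 * pi * fst s) (2 * pi * snd s) * vandermonde (2 * pi * fst s) (2 * pi * snd s)\<bar>
      * ?w (alcove_x s, alcove_y s) = 16 * pi ^ 4 / 9 * alcove_monom k l s" for s
  proof -
    define Y V where "Y = deltoid_im (2 * pi * fst s) (2 * pi * snd s)"
      "V = vandermonde (2 * pi * fst s) (2 * pi * snd s)"
    have P: "weight_poly1 (alcove_x s) (alcove_y s) = Y ^ 2 / 3"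
      and Q: "weight_poly2 (alcove_x s) (alcove_y s) = V ^ 2 / 9"
      unfolding weight_poly_alcove Y_V_def by simp_all
    have "weight (1/2) (1/2) (alcove_x s, alcove_y s)
        = (4 * pi ^ 2) powr 1 / 3 powr (3/2) * (Y ^ 2 / 3) powr (1/2) * (V ^ 2 / 9) powr (1/2)"
      unfolding P[symmetric] Q[symmetric] weight_poly1_def weight_poly2_def weight_def by simp
    also have "\<dots> = 4 * pi ^ 2 / (3 * sqrt 3) * (\<bar>Y\<bar> / sqrt 3) * (\<bar>V\<bar> / 3)"
    proof -
      have "(3 :: real) powr (3/2) = 3 powr (1 + 1/2)" by simp
      also have "\<dots> = 3 * sqrt 3" by (simp only: powr_add powr_half_sqrt) (simp add: powr_half_sqrt)
      finally have "(3 :: real) powr (3/2) = 3 * sqrt 3" .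
      moreover have "sqrt 9 = 3" using real_sqrt_abs[of 3] by simp
      ultimately show ?thesis
        by (simp add: powr_half_sqrt real_sqrt_divide)
    qed
    also have "\<dots> = 4 * pi ^ 2 / 27 * \<bar>Y * V\<bar>"
      by (simp add: abs_mult)
    finally have w: "weight (1/2) (1/2) (alcove_x s, alcove_y s) = 4 * pi ^ 2 / 27 * \<bar>Y * V\<bar>" .
    have "\<bar>Y * V\<bar> * \<bar>Y * V\<bar> = Y ^ 2 * V ^ 2"
      by (simp add: power2_eq_square)
    then show ?thesis
      unfolding w alcove_monom_def P Q Y_V_def[symmetric] g_def
      by (simp add: field_simps power2_eq_square power4_eq_xxxx)
  qed
  note eq = this
  have "continuous_on alcove (\<lambda>s. 16 * pi ^ 4 / 9 * alcove_monom k l s)"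
    unfolding alcove_monom_def weight_poly1_def weight_poly2_def alcove_x_def alcove_y_def deltoid_re_def deltoid_im_def
    by (intro continuous_intros) auto
  then have "set_integrable lborel alcove (\<lambda>s. 16 * pi ^ 4 / 9 * alcove_monom k l s)"
    unfolding set_integrable_def by (rule borel_integrable_compact[OF compact_alcove])
  note jac = alcove_jacobian[OF mw, unfolded eq, OF this]
  show "set_integrable lborel tri_star ?w" by (rule jac(1))
  show "(LINT p:tri_star|lborel. ?w p) = 16 * pi ^ 4 / 9 * (LINT s:alcove|lborel. alcove_monom k l s)"
    unfolding jac(2) by simp
qed

section \<open>Degree and symmetries of the integrand\<close>

lemma trig_poly_cos:
  assumes "\<bar>2 * k - l\<bar> \<le> int N" "\<bar>2 * l - k\<bar> \<le> int N" "\<bar>k + l\<bar> \<le> int N"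
  shows "trig_poly N (\<lambda>s. of_real (cos (2 * pi * (of_int k * fst s + of_int l * snd s))))"
proof -
  have "of_real (cos (2 * pi * (of_int k * fst s + of_int l * snd s))) = 1/2 * (expo k l s + expo (- k) (- l) s)" for s
  proof -
    have "of_int (- k) * fst s + of_int (- l) * snd s = - (of_int k * fst s + of_int l * snd s)" by simp
    then have "expo (- k) (- l) s = cis (- (2 * pi * (of_int k * fst s + of_int l * snd s)))"
      unfolding expo_def by (simp only: mult_minus_right)
    then show ?thesis by (simp add: expo_def complex_eq_iff del: minus_add_distrib)
  qed
  moreover have "trig_poly N (\<lambda>s. 1/2 * (expo k l s + expo (- k) (- l) s))"
    using assms by (intro trig_poly.scale trig_poly.add trig_poly.expo) auto
  ultimately show ?thesis by (simp only:)
qed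

lemma trig_poly_alcove_x: "trig_poly 2 (\<lambda>s. of_real (alcove_x s))"
proof -
  have "(of_real (alcove_x s) :: complex) = 1/3 * (of_real (cos (2 * pi * (of_int 1 * fst s + of_int 0 * snd s)))
      + of_real (cos (2 * pi * (of_int 0 * fst s + of_int 1 * snd s)))
      + of_real (cos (2 * pi * (of_int 1 * fst s + of_int 1 * snd s))))" for s
  proof -
    have cs: "alcove_x s = (cos (2 * pi * fst s) + cos (2 * pi * snd s) + cos (2 * pi * (fst s + snd s))) / 3"
      using alcove_x_cos[of "fst s" "snd s"] by simp
    show ?thesis unfolding cs by simp
  qed
  moreover have "trig_poly 2 (\<lambda>s. 1/3 * (of_real (cos (2 * pi * (of_int 1 * fst s + of_int 0 * snd s)))
      + of_real (cos (2 * pi * (of_int 0 * fst s + of_int 1 * snd s)))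
      + of_real (cos (2 * pi * (of_int 1 * fst s + of_int 1 * snd s)))))"
    by (intro trig_poly.scale trig_poly.add trig_poly_cos) auto
  ultimately show ?thesis by (simp only:)
qed

lemma trig_poly_alcove_y: "trig_poly 3 (\<lambda>s. of_real (alcove_y s))"
proof -
  have "(of_real (alcove_y s) :: complex) = 1/3 * (of_real (cos (2 * pi * (of_int 2 * fst s + of_int 1 * snd s)))
      + of_real (cos (2 * pi * (of_int (- 1) * fst s + of_int 1 * snd s)))
      + of_real (cos (2 * pi * (of_int 1 * fst s + of_int 2 * snd s))))" for s
  proof -
    have cs: "alcove_y s = (cos (2 * pi * (2 * fst s + snd s)) + cos (2 * pi * (snd s - fst s)) + cos (2 * pi * (fst s + 2 * snd s))) / 3"
      using alcove_y_cos[of "fst s" "snd s"] by simp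
    show ?thesis unfolding cs by simp
  qed
  moreover have "trig_poly 3 (\<lambda>s. 1/3 * (of_real (cos (2 * pi * (of_int 2 * fst s + of_int 1 * snd s)))
      + of_real (cos (2 * pi * (of_int (- 1) * fst s + of_int 1 * snd s)))
      + of_real (cos (2 * pi * (of_int 1 * fst s + of_int 2 * snd s)))))"
    by (intro trig_poly.scale trig_poly.add trig_poly_cos) auto
  ultimately show ?thesis by (simp only:)
qed

lemma trig_poly_xy_monom:
  assumes "2 * k + 3 * l \<le> N"
  shows "trig_poly N (\<lambda>s. c * (of_real (alcove_x s) ^ k * of_real (alcove_y s) ^ l))"
proof -
  have "trig_poly (k * 2 + l * 3) (\<lambda>s. of_real (alcove_x s) ^ k * of_real (alcove_y s) ^ l)"
    by (rule trig_poly_mult[OF trig_poly_power[OF trig_poly_alcove_x] trig_poly_power[OF trig_poly_alcove_y]])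
  moreover have "k * 2 + l * 3 \<le> N" using assms by simp
  ultimately show ?thesis by (rule trig_poly.scale[OF trig_poly_mono])
qed

text \<open>With x of degree 2 and y of degree 3 the weight factors have degrees 4 and 6. This 10 is
  the reason for the shift in \<open>n + 5\<close>:
  \<open>10 + (2 * n - 1) < 2 * (n + 5)\<close>.\<close>

lemma trig_poly_alcove_monom: "trig_poly (10 + (2 * k + 3 * l)) (\<lambda>s. of_real (alcove_monom k l s))"
proof -
  let ?m = "\<lambda>c i j s. c * (of_real (alcove_x s) ^ i * of_real (alcove_y s) ^ j) :: complex"
  have P: "of_real (weight_poly1 (alcove_x s) (alcove_y s)) = ?m 1 0 0 s + ?m 2 0 1 s + ?m (-3) 2 0 s" for s
    by (simp add: weight_poly1_def)
  have Q: "of_real (weight_poly2 (alcove_x s) (alcove_y s))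
      = ?m 24 3 0 s + ?m (-1) 0 2 s + ?m (-12) 1 1 s + ?m (-6) 1 0 s + ?m (-4) 0 1 s + ?m (-1) 0 0 s" for s
    by (simp add: weight_poly2_def)
  have "trig_poly 4 (\<lambda>s. of_real (weight_poly1 (alcove_x s) (alcove_y s)))"
    unfolding P by (intro trig_poly.add; rule trig_poly_xy_monom; simp)
  moreover have "trig_poly 6 (\<lambda>s. of_real (weight_poly2 (alcove_x s) (alcove_y s)))"
    unfolding Q by (intro trig_poly.add; rule trig_poly_xy_monom; simp)
  ultimately have "trig_poly (4 + 6) (\<lambda>s. of_real (weight_poly1 (alcove_x s) (alcove_y s))
      * of_real (weight_poly2 (alcove_x s) (alcove_y s)))"
    by (rule trig_poly_mult)
  from trig_poly_mult[OF this trig_poly_xy_monom[of k l "2 * k + 3 * l" 1]]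
  show ?thesis by (simp add: alcove_monom_def)
qed

text \<open>The first two maps permute the three unit numbers and the third conjugates them; x and y
  depend only on the real part and the modulus of their sum.\<close>

lemma alcove_xy_symmetries:
  "alcove_x (t, s) = alcove_x (s, t)" "alcove_y (t, s) = alcove_y (s, t)"
  "alcove_x (1 - s - t, t) = alcove_x (s, t)" "alcove_y (1 - s - t, t) = alcove_y (s, t)"
  "alcove_x (1 - s, 1 - t) = alcove_x (s, t)" "alcove_y (1 - s, 1 - t) = alcove_y (s, t)"
proof -
  have sc: "sin (2 * pi * (1 - u)) = - sin (2 * pi * u)" "cos (2 * pi * (1 - u)) = cos (2 * pi * u)" for u
    by (simp_all add: right_diff_distrib sin_diff cos_diff)
  have sc2: "sin (2 * pi * (2 - u)) = - sin (2 * pi * u)" "cos (2 * pi * (2 - u)) = cos (2 * pi * u)" for u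
    using sin_periodic[of "2 * pi * (1 - u)"] cos_periodic[of "2 * pi * (1 - u)"] sc[of u]
    by (simp_all add: algebra_simps)
  have sum: "2 * pi * p + 2 * pi * q = 2 * pi * (p + q)" for p q by (simp add: algebra_simps)
  have e: "1 - s - t = 1 - (s + t)" "1 - s - t + t = 1 - s" "1 - s + (1 - t) = 2 - (s + t)" by simp_all
  show "alcove_x (t, s) = alcove_x (s, t)" "alcove_y (t, s) = alcove_y (s, t)"
    by (simp_all add: alcove_x_def alcove_y_def deltoid_re_def deltoid_im_def add.commute)
  show "alcove_x (1 - s - t, t) = alcove_x (s, t)" "alcove_y (1 - s - t, t) = alcove_y (s, t)"
    "alcove_x (1 - s, 1 - t) = alcove_x (s, t)" "alcove_y (1 - s, 1 - t) = alcove_y (s, t)"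
    unfolding alcove_x_def alcove_y_def deltoid_re_def deltoid_im_def fst_conv snd_conv sum e(2,3)
    unfolding e(1) sc sc2
    by (simp_all add: power2_eq_square algebra_simps)
qed

lemma alcove_monom_integral:
  assumes "10 + (2 * k + 3 * l) < 2 * M"
  shows "(LINT s:alcove|lborel. alcove_monom k l s)
       = (\<Sum>(p, q)\<in>alcove_nodes M. alcove_monom k l (of_int p / real M, of_int q / real M)) / real M ^ 2"
proof (rule alcove_integral[OF trig_poly_alcove_monom _ _ _ _ _ assms])
  fix x y
  show "alcove_monom k l (y, x) = alcove_monom k l (x, y)"
    "alcove_monom k l (1 - x - y, y) = alcove_monom k l (x, y)"
    "alcove_monom k l (1 - x, 1 - y) = alcove_monom k l (x, y)"
    by (simp_all only: alcove_monom_def alcove_xy_symmetries(3-6)) (simp add: alcove_xy_symmetries(1,2))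
  \<comment> \<open>The imaginary part vanishes on the first wall, the Vandermonde factor on the
    diagonal.\<close>
  show "alcove_monom k l (0, y) = 0" "alcove_monom k l (x, x) = 0"
    by (simp_all add: alcove_monom_def weight_poly_alcove deltoid_im_def vandermonde_def)
qed

text \<open>For \<open>M = 6\<close> there is a single node, so the normalization is read off from one value of the integrand.\<close>

lemma alcove_monom_0_0_integral: "(LINT s:alcove|lborel. alcove_monom 0 0 s) = 1 / 432"
proof -
  have "alcove_nodes 6 = {(1, 2)}" by (auto simp: alcove_nodes_def)
  then have "(LINT s:alcove|lborel. alcove_monom 0 0 s) = alcove_monom 0 0 (1 / 6, 2 / 6) / 36"
    using alcove_monom_integral[of 0 0 6] by simp
  moreover have "alcove_monom 0 0 (1 / 6, 2 / 6) = 1 / 12"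
  proof -
    have ang: "2 * pi * (1 / 6) = pi / 3" "2 * pi * (2 / 6) = 2 * pi / 3" "pi / 3 + 2 * pi / 3 = pi" by simp_all
    have "deltoid_re (2 * pi * (1 / 6)) (2 * pi * (2 / 6)) = -1"
      "deltoid_im (2 * pi * (1 / 6)) (2 * pi * (2 / 6)) = sqrt 3"
      unfolding ang deltoid_re_def deltoid_im_def by (simp_all add: cos_60 cos_120 sin_60 sin_120)
    then have "alcove_x (1 / 6, 2 / 6) = - 1 / 3" "alcove_y (1 / 6, 2 / 6) = 1 / 6"
      unfolding alcove_x_def alcove_y_def fst_conv snd_conv by simp_all
    then show ?thesis
      by (simp only: alcove_monom_def weight_poly1_def weight_poly2_def) (simp add: power2_eq_square power3_eq_cube)
  qed
  ultimately show ?thesis by simp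
qed

text \<open>The congruence modulo 3 is what makes \<open>(j1 - j2) / 3\<close> and
  \<open>(j1 + 2 * j2) / 3\<close> integers. The inequalities \<open>j2 < j1\<close>,
  \<open>0 < j2\<close> and \<open>- j3 < M\<close> become \<open>0 < p\<close>,
  \<open>p < q\<close> and \<open>p + 2 * q < M\<close>.\<close>

lemma sum_Upsilon_int:
  fixes g :: "real \<times> real \<times> real \<Rightarrow> 'b::comm_monoid_add"
  shows "(\<Sum>j\<in>Upsilon_int (int M). g (node (int M) j))
     = (\<Sum>(p, q)\<in>alcove_nodes M. let s = of_int p / real M; t = of_int q / real M
          in g (2 * s + t, t - s, - s - 2 * t))"
proof (rule sum.reindex_bij_witness[of _ "\<lambda>(p, q). (2 * p + q, q - p, - p - 2 * q)"
      "\<lambda>(j1, j2, j3). ((j1 - j2) div 3, (j1 + 2 * j2) div 3)"])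
  fix j assume "j \<in> Upsilon_int (int M)"
  moreover obtain j1 j2 j3 where j: "j = (j1, j2, j3)" by (cases j)
  ultimately have *: "j1 + j2 + j3 = 0" "[j1 = j2] (mod 3)" "0 < j2" "j2 < j1" "- j3 < int M"
    by (auto simp: Upsilon_int_def)
  from *(2) obtain p where p: "j1 - j2 = 3 * p"
    by (auto simp: cong_iff_dvd_diff)
  define q where "q = j2 + p"
  have pq: "j1 = 2 * p + q" "j2 = q - p" "j3 = - p - 2 * q" "j1 + 2 * j2 = 3 * q"
    using p *(1) by (auto simp: q_def)
  have w: "(\<lambda>(j1, j2, j3). ((j1 - j2) div 3, (j1 + 2 * j2) div 3)) j = (p, q)"
    unfolding j case_prod_conv p pq(4) by simp
  show "(\<lambda>(p, q). (2 * p + q, q - p, - p - 2 * q)) ((\<lambda>(j1, j2, j3). ((j1 - j2) div 3, (j1 + 2 * j2) div 3)) j) = j"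
    unfolding w by (simp add: j pq)
  show "(\<lambda>(j1, j2, j3). ((j1 - j2) div 3, (j1 + 2 * j2) div 3)) j \<in> alcove_nodes M"
    unfolding w using * pq by (auto simp: alcove_nodes_def)
  show "(case (\<lambda>(j1, j2, j3). ((j1 - j2) div 3, (j1 + 2 * j2) div 3)) j of
      (p, q) \<Rightarrow> let s = of_int p / real M; t = of_int q / real M in g (2 * s + t, t - s, - s - 2 * t)) = g (node (int M) j)"
    unfolding w by (simp add: node_def j pq Let_def add_divide_distrib diff_divide_distrib)
next
  fix i assume "i \<in> alcove_nodes M"
  moreover obtain p q where i: "i = (p, q)" by (cases i)
  ultimately have *: "0 < p" "p < q" "p + 2 * q < int M" by (auto simp: alcove_nodes_def)
  have d: "2 * p + q - (q - p) = 3 * p" "2 * p + q + 2 * (q - p) = 3 * q" "q - p - (- p - 2 * q) = 3 * q" by simp_all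
  show "(\<lambda>(j1, j2, j3). ((j1 - j2) div 3, (j1 + 2 * j2) div 3)) ((\<lambda>(p, q). (2 * p + q, q - p, - p - 2 * q)) i) = i"
    unfolding i case_prod_conv d by simp
  show "(\<lambda>(p, q). (2 * p + q, q - p, - p - 2 * q)) i \<in> Upsilon_int (int M)"
    unfolding i case_prod_conv Upsilon_int_def mem_Collect_eq cong_iff_dvd_diff d using * by simp
qed

text \<open>Normalization turns the integral into \<open>432 * S / M ^ 2\<close>, while the node sum
  with the squares of \<open>SS\<close> is \<open>3 * S\<close>; the quotient gives 144.\<close>

lemma cubature_monom:
  assumes "2 * k + 3 * l \<le> 2 * n - 1" "n \<ge> 1"
  shows "weight_const (1/2) (1/2) * (LINT p:tri_star|lborel. weight (1/2) (1/2) p * (fst p ^ k * snd p ^ l))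
       = 144 / (real n + 5) ^ 2 *
           (\<Sum>j\<in>Upsilon_int (int n + 5). \<bar>SS (2, 1, -3) (node (int n + 5) j)\<bar> ^ 2 *
              (x_coord (node (int n + 5) j) ^ k * y_coord (node (int n + 5) j) ^ l))"
proof -
  define M where "M = n + 5"
  have M: "int n + 5 = int M" "real n + 5 = real M" by (simp_all add: M_def)
  define S where "S = (\<Sum>(p, q)\<in>alcove_nodes M. alcove_monom k l (of_int p / real M, of_int q / real M))"
  have "(\<Sum>j\<in>Upsilon_int (int M). \<bar>SS (2, 1, -3) (node (int M) j)\<bar> ^ 2 *
              (x_coord (node (int M) j) ^ k * y_coord (node (int M) j) ^ l)) = 3 * S"
    unfolding S_def sum_distrib_left
    by (subst sum_Upsilon_int[of "\<lambda>j. \<bar>SS (2, 1, -3) j\<bar> ^ 2 * (x_coord j ^ k * y_coord j ^ l)"])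
       (auto simp only: Let_def coord_alcove power2_abs SS_sq_alcove alcove_monom_def mult.assoc intro!: sum.cong)
  moreover have "(LINT p:tri_star|lborel. weight (1/2) (1/2) p * (fst p ^ k * snd p ^ l)) = 16 * pi ^ 4 / 9 * (S / real M ^ 2)"
    unfolding weight_integral S_def using assms by (subst alcove_monom_integral[of k l M]) (auto simp: M_def)
  moreover have "weight_const (1/2) (1/2) = 432 / (16 * pi ^ 4 / 9)"
  proof -
    have "(LINT p:tri_star|lborel. weight (1/2) (1/2) p) = 16 * pi ^ 4 / 9 / 432"
      using weight_integral(2)[of 0 0] by (simp add: alcove_monom_0_0_integral)
    then have "weight_const (1/2) (1/2) = 1 / (16 * pi ^ 4 / 9 / 432)"
      by (simp only: weight_const_def)
    then show ?thesis by simp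
  qed
  ultimately show ?thesis unfolding M by simp
qed

section \<open>Linear extension from monomials to all polynomials\<close>

lemma module_fun_mult: "module (\<lambda>(c :: 'a::comm_ring_1) (f :: 'b \<Rightarrow> 'a) p. c * f p)"
  by unfold_locales (simp_all add: fun_eq_iff algebra_simps)

theorem theorem6p1:
  fixes n :: nat
    and f :: "real \<times> real \<Rightarrow> 'a::{real_normed_field, euclidean_space}"
  assumes "n \<ge> 1"
    and "f \<in> Pi_star (2 * n - 1)"
  shows "weight_const (1/2) (1/2) *\<^sub>R (LINT p:tri_star|lborel. weight (1/2) (1/2) p *\<^sub>R f p)
       = (144 / (real n + 5)^2) *\<^sub>R
           (\<Sum>j\<in>Upsilon_int (int n + 5). \<bar>SS (2, 1, -3) (node (int n + 5) j)\<bar>^2 *\<^sub>R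
              f (x_coord (node (int n + 5) j), y_coord (node (int n + 5) j)))"
proof -
  let ?w = "weight (1/2) (1/2)"
  define I :: "(real \<times> real \<Rightarrow> 'a) \<Rightarrow> 'a" where "I g = (LINT p:tri_star|lborel. ?w p *\<^sub>R g p)" for g
  define R :: "(real \<times> real \<Rightarrow> 'a) \<Rightarrow> 'a" where
    "R g = (\<Sum>j\<in>Upsilon_int (int n + 5). \<bar>SS (2, 1, -3) (node (int n + 5) j)\<bar>^2 *\<^sub>R
              g (x_coord (node (int n + 5) j), y_coord (node (int n + 5) j)))" for g
  \<comment> \<open>Integrability belongs to the induction predicate because additivity of the
    integral relies on it.\<close>
  define exact where "exact g \<longleftrightarrow> set_integrable lborel tri_star (\<lambda>p. ?w p *\<^sub>R g p) \<and>
      weight_const (1/2) (1/2) *\<^sub>R I g = (144 / (real n + 5)^2) *\<^sub>R R g" for g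
  have "exact f"
    using assms(2) unfolding Pi_star_def
  proof (rule module.span_induct_alt[OF module_fun_mult])
    show "exact 0" by (simp add: exact_def I_def R_def set_integrable_def)
  next
    fix c :: 'a and x y :: "real \<times> real \<Rightarrow> 'a"
    assume "x \<in> {(\<lambda>(x, y). of_real (x ^ k1 * y ^ k2)) | k1 k2. 2 * k1 + 3 * k2 \<le> 2 * n - 1}"
    then obtain k l where x: "x = (\<lambda>p. of_real (fst p ^ k * snd p ^ l))" and kl: "2 * k + 3 * l \<le> 2 * n - 1"
      unfolding case_prod_beta by blast
    assume y: "exact y"
    let ?g = "\<lambda>p. ?w p * (fst p ^ k * snd p ^ l)"
    \<comment> \<open>Coefficients lie in \<open>'a\<close> but the monomials are real, so the real
      rule is carried over by \<open>of_real\<close>.\<close>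
    have wx: "?w p *\<^sub>R x p = of_real (?g p)" for p
      by (simp add: x scaleR_conv_of_real)
    have ind: "indicator tri_star p *\<^sub>R (of_real r :: 'a) = of_real (indicator tri_star p *\<^sub>R r)" for p r
      by (simp add: scaleR_conv_of_real)
    have ix: "set_integrable lborel tri_star (\<lambda>p. ?w p *\<^sub>R x p)"
      using weight_integral(1)[of k l] unfolding set_integrable_def wx ind
      by (rule integrable_bounded_linear[OF bounded_linear_of_real])
    have Ix: "I x = of_real (LINT p:tri_star|lborel. ?g p)"
      using weight_integral(1)[of k l] unfolding I_def set_lebesgue_integral_def set_integrable_def wx ind
      by (rule integral_bounded_linear[OF bounded_linear_of_real])
    have Rx: "R x = of_real (\<Sum>j\<in>Upsilon_int (int n + 5). \<bar>SS (2, 1, -3) (node (int n + 5) j)\<bar> ^ 2 *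
              (x_coord (node (int n + 5) j) ^ k * y_coord (node (int n + 5) j) ^ l))"
      by (simp add: R_def x scaleR_conv_of_real)
    have ex: "weight_const (1/2) (1/2) *\<^sub>R I x = (144 / (real n + 5)^2) *\<^sub>R R x"
      unfolding Ix Rx scaleR_conv_of_real of_real_mult[symmetric] cubature_monom[OF kl assms(1)] ..
    have eq: "?w p *\<^sub>R ((\<lambda>p. c * x p) + y) p = c * (?w p *\<^sub>R x p) + ?w p *\<^sub>R y p" for p
      by (simp add: scaleR_add_right)
    have icx: "set_integrable lborel tri_star (\<lambda>p. c * (?w p *\<^sub>R x p))"
      using ix by (rule set_integrable_mult_right)
    have iy: "set_integrable lborel tri_star (\<lambda>p. ?w p *\<^sub>R y p)"
      using y by (simp add: exact_def)
    have "I ((\<lambda>p. c * x p) + y) = c * I x + I y"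
      unfolding I_def eq using set_integral_add(2)[OF icx iy] by (simp only: set_integral_mult_right)
    moreover have "R ((\<lambda>p. c * x p) + y) = c * R x + R y"
      by (simp add: R_def scaleR_add_right sum.distrib sum_distrib_left)
    moreover have "set_integrable lborel tri_star (\<lambda>p. ?w p *\<^sub>R ((\<lambda>p. c * x p) + y) p)"
      unfolding eq using icx iy by (rule set_integral_add(1))
    ultimately show "exact ((\<lambda>p. c * x p) + y)"
      using y ex unfolding exact_def
      by (simp add: scaleR_add_right flip: mult_scaleR_right)
  qed
  then show ?thesis by (simp add: exact_def I_def R_def)
qed

end
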